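(* If $G$ is a tree with $\operatorname{diam}(G) \leq 5$, then the $r$-independence complex $\mathrm{Ind}_r(G)$ is shellable for all integers $r \geq 2$.
   Context: $\operatorname{diam}(G)$ is the maximum over pairs of vertices of the length of a shortest path between them. For $r \geq 1$, a subset $A \subseteq V(G)$ is $r$-independent if every connected component of the induced subgraph $G[A]$ has at most $r$ vertices; $\mathrm{Ind}_r(G)$ is the simplicial complex on $V(G)$ of all $r$-independent subsets. A (not necessarily pure) simplicial complex is shellable if its facets can be ordered $F_1,\dots,F_t$ so that for each $k>1$, $\langle F_k\rangle \cap \langle F_1,\dots,F_{k-1}\rangle$ is pure of dimension $\dim F_k-1$ ($\langle\mathcal F\rangle$ = complex generated by $\mathcal F$). *)

theory Defs
  imports "Graph_Theory.Graph_Theory"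
begin

(* Finite simple graphs are the symmetric, loop-free digraphs without parallel arcs of the
   library locale "graph": an edge uv is the pair of opposite arcs u -> v and v -> u.

   The library predicates "forest" and "tree" are not usable for them, because
   pre_digraph.cycle counts the closed walk u, v, u along a single edge as a cycle. The
   cycles of a simple graph are exactly the library cycles of length at least 3. *)
definition simple_tree :: "('a, 'b) pre_digraph \<Rightarrow> bool" where
  "simple_tree G \<longleftrightarrow> graph G \<and> connected G \<and> \<not> (\<exists>p. pre_digraph.cycle G p \<and> 3 \<le> length p)"

(* With unit weights, the library's shortest-path value is the number of edges of a shortest
   path (and infinity if there is none). *)
definition graph_diam :: "('a, 'b) pre_digraph \<Rightarrow> ereal" where
  "graph_diam G = Max {wf_digraph.\<mu> G (\<lambda>_. 1) u v |u v. u \<in> verts G \<and> v \<in> verts G}"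

definition connected_component :: "('a, 'b) pre_digraph \<Rightarrow> ('a, 'b) pre_digraph \<Rightarrow> bool" where
  "connected_component G C \<longleftrightarrow> pre_digraph.max_subgraph G connected C"

definition r_independent :: "nat \<Rightarrow> ('a, 'b) pre_digraph \<Rightarrow> 'a set \<Rightarrow> bool" where
  "r_independent r G A \<longleftrightarrow>
     A \<subseteq> verts G \<and> (\<forall>C. connected_component (G \<restriction> A) C \<longrightarrow> card (verts C) \<le> r)"

definition Ind :: "nat \<Rightarrow> ('a, 'b) pre_digraph \<Rightarrow> 'a set set" where
  "Ind r G = {A. r_independent r G A}"

(* Abstract simplicial complexes are represented by their sets of faces, the empty face
   included. *)
definition simplicial_complex_on :: "'a set \<Rightarrow> 'a set set \<Rightarrow> bool" where
  "simplicial_complex_on V K \<longleftrightarrow> finite V \<and> K \<subseteq> Pow V \<and> {} \<in> K \<and> (\<forall>v \<in> V. {v} \<in> K) \<and>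
     (\<forall>A \<in> K. \<forall>B. B \<subseteq> A \<longrightarrow> B \<in> K)"

definition facets :: "'a set set \<Rightarrow> 'a set set" where
  "facets K = {F \<in> K. \<forall>F' \<in> K. F \<subseteq> F' \<longrightarrow> F' = F}"

definition generated_complex :: "'a set set \<Rightarrow> 'a set set" where
  "generated_complex \<F> = {S. \<exists>F \<in> \<F>. S \<subseteq> F}"

(* The empty face has dimension -1. *)
definition face_dim :: "'a set \<Rightarrow> int" where
  "face_dim F = int (card F) - 1"

definition pure_of_dim :: "int \<Rightarrow> 'a set set \<Rightarrow> bool" where
  "pure_of_dim d K \<longleftrightarrow> K \<noteq> {} \<and> (\<forall>F \<in> facets K. face_dim F = d)"

(* Nonpure shellability. Lists are indexed from 0, so the condition at position k > 0 is the
   one for the (k+1)-st facet. *)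
definition shellable :: "'a set set \<Rightarrow> bool" where
  "shellable K \<longleftrightarrow> (\<exists>Fs. distinct Fs \<and> set Fs = facets K \<and>
     (\<forall>k. 0 < k \<and> k < length Fs \<longrightarrow>
        pure_of_dim (face_dim (Fs ! k) - 1)
          (generated_complex {Fs ! k} \<inter> generated_complex (set (take k Fs)))))"

lemma connected_subgraph_in_component:
  assumes "fin_digraph H" "subgraph C H" "connected C"
  obtains D where "connected_component H D" "subgraph C D"
proof -
  interpret fin_digraph H by fact
  let ?P = "\<lambda>X. subgraph X H \<and> connected X \<and> subgraph C X"
  let ?m = "\<lambda>X. card (verts X) + card (arcs X)"
  have C: "?P C" using assms by (auto intro: wf_digraph.subgraph_refl)
  have b: "\<forall>X. ?P X \<longrightarrow> ?m X < Suc (?m H)"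
    by (auto simp: subgraph_def less_Suc_eq_le intro!: add_mono card_mono)
  have "\<exists>D. ?P D \<and> (\<forall>X. ?P X \<longrightarrow> ?m X \<le> ?m D)"
    by (rule ex_has_greatest_nat[where P = ?P and f = ?m, OF C b])
  then obtain D where D: "?P D" and m: "\<And>X. ?P X \<Longrightarrow> ?m X \<le> ?m D"
    by (elim exE conjE) simp
  have "X = D" if X: "subgraph D X" "subgraph X H" "connected X" for X
  proof -
    have "?P X" using X D subgraph_trans by blast
    then have le: "?m X \<le> ?m D" by (rule m)
    have fin: "finite (verts X)" "finite (arcs X)"
      using X by (auto simp: subgraph_def intro: finite_subset)
    have sub: "verts D \<subseteq> verts X" "arcs D \<subseteq> arcs X" using X by (auto simp: subgraph_def)
    have "card (verts D) \<le> card (verts X)" "card (arcs D) \<le> card (arcs X)"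
      using fin sub by (auto intro: card_mono)
    with le have "card (verts D) = card (verts X)" "card (arcs D) = card (arcs X)" by auto
    then have "verts D = verts X" "arcs D = arcs X"
      using fin sub by (auto simp: card_subset_eq)
    then show ?thesis using X by (auto simp: subgraph_def compatible_def)
  qed
  then have "connected_component H D"
    using D unfolding connected_component_def pre_digraph.max_subgraph_def by blast
  then show ?thesis using that D by blast
qed

lemma Ind_downward_closed:
  assumes "graph G" "A \<in> Ind r G" "B \<subseteq> A"
  shows "B \<in> Ind r G"
proof -
  interpret graph G by fact
  have A: "A \<subseteq> verts G" and small: "\<And>C. connected_component (G \<restriction> A) C \<Longrightarrow> card (verts C) \<le> r"
    using assms by (auto simp: Ind_def r_independent_def)
  have fin: "fin_digraph (G \<restriction> A)"
    using fin_digraph_subgraph A by (blast intro: induced_imp_subgraph induced_induce)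
  have sub: "subgraph (G \<restriction> B) (G \<restriction> A)"
    using assms(3) by (auto simp: subgraph_def compatible_def)
  have "card (verts C) \<le> r" if C: "connected_component (G \<restriction> B) C" for C
  proof -
    have C': "subgraph C (G \<restriction> A)" "connected C"
      using C sub subgraph_trans
      unfolding connected_component_def pre_digraph.max_subgraph_def by blast+
    obtain D where D: "connected_component (G \<restriction> A) D" "subgraph C D"
      using connected_subgraph_in_component[OF fin C'] by blast
    have "finite (verts D)"
      using D fin unfolding connected_component_def pre_digraph.max_subgraph_def
      by (metis finite_subset subgraph_def fin_digraph.finite_verts)
    then have "card (verts C) \<le> card (verts D)"
      using D(2) by (auto simp: subgraph_def intro: card_mono)
    then show ?thesis using small[OF D(1)] by linarith
  qed
  then show ?thesis using A assms(3) by (auto simp: Ind_def r_independent_def)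
qed

lemma Ind_simplicial_complex:
  assumes "graph G" "1 \<le> r"
  shows "simplicial_complex_on (verts G) (Ind r G)"
proof -
  interpret graph G by fact
  have small: "A \<in> Ind r G" if A: "A \<subseteq> verts G" "card A \<le> 1" for A
  proof -
    have "card (verts C) \<le> r" if "connected_component (G \<restriction> A) C" for C
    proof -
      have "verts C \<subseteq> A"
        using that unfolding connected_component_def pre_digraph.max_subgraph_def
        by (auto simp: subgraph_def)
      then have "card (verts C) \<le> card A"
        using A finite_verts by (meson card_mono finite_subset)
      then show ?thesis using A assms(2) by linarith
    qed
    then show ?thesis using A by (auto simp: Ind_def r_independent_def)
  qed
  show ?thesis
    unfolding simplicial_complex_on_def
  proof (intro conjI ballI allI impI)
    show "finite (verts G)" by simp
    show "Ind r G \<subseteq> Pow (verts G)" by (auto simp: Ind_def r_independent_def)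
    show "{} \<in> Ind r G" by (rule small) simp_all
    show "{v} \<in> Ind r G" if "v \<in> verts G" for v using that by (intro small) simp_all
    show "B \<in> Ind r G" if "A \<in> Ind r G" "B \<subseteq> A" for A B
      using Ind_downward_closed[OF assms(1) that] .
  qed
qed

end

(* A tree of diameter at most 5 with at least two vertices is a double star: every vertex has
   distance at most 2 from the two ends a, b of a central edge. The complex is shelled by vertex
   decomposition. For disjoint S and V consider the faces A on V for which all components of
   A Un S have at most r vertices. As long as every leaf in S has lost its parent from V, and
   every child of a root in S whose root is still in V has at least r leaves in V, some vertex of
   V is a cone point or a shedding vertex that preserves this condition. The exchange property
   behind shedding is that a vertex v can be replaced by a vertex w just outside its component,
   because w joins at most what v leaves. *)

theory Submission
  imports Defs
begin

text \<open>The difficulty is that contracted vertices add to components without being counted by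
  \<open>leaves\<close>. The first clause of \<open>valid\<close> ensures that a child still in
  \<open>V\<close> has only leaves from \<open>V\<close> in \<open>S \<union> V\<close>, so that it
  and its leaves form a star of known size. The second clause keeps the root above a contracted
  child removable: the many leaves of that child always offer a replacement for the root. Once the
  vertices found in this way are gone, every child in \<open>V\<close> has fewer than
  \<open>r\<close> leaves, and deleting a root of \<open>V\<close> breaks its branch into components
  with at most \<open>r\<close> vertices. This is where depth two enters: such a component is a star
  or a single leaf. The remaining hard case is a contracted root, which ties its children together
  and can no longer be deleted. There the children have to replace each other, which works in order
  of decreasing number of leaves.\<close>

section \<open>Shellings under cones and shedding vertices\<close>

text \<open>For distinct facets this is equivalent to the purity condition in \<open>shellable\<close>, and it is
  easier to transport along insertions.\<close>

definition shelling_order :: "'a set list \<Rightarrow> bool" where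
  "shelling_order Fs \<longleftrightarrow> distinct Fs \<and>
     (\<forall>k < length Fs. \<forall>j < k. \<exists>i < k. \<exists>x \<in> Fs ! k.
        Fs ! j \<inter> Fs ! k \<subseteq> Fs ! k - {x} \<and> Fs ! k - {x} \<subseteq> Fs ! i)"

text \<open>A face of the intersection lies in some \<open>Fs ! j \<inter> Fs ! k\<close>, hence in
  a ridge \<open>Fs ! k - {x}\<close> that is itself in the intersection. So the maximal faces are
  such ridges.\<close>

lemma shelling_order_imp_shellable:
  assumes "shelling_order Fs" "set Fs = facets K" "\<And>F. F \<in> K \<Longrightarrow> finite F"
  shows "shellable K"
  unfolding shellable_def
proof (intro exI[of _ Fs] conjI allI impI)
  show "distinct Fs" using assms(1) by (simp add: shelling_order_def)
  show "set Fs = facets K" by fact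
  fix k assume k: "0 < k \<and> k < length Fs"
  let ?I = "generated_complex {Fs ! k} \<inter> generated_complex (set (take k Fs))"
  have fin: "finite (Fs ! k)"
    using assms(2,3) k nth_mem by (fastforce simp: facets_def)
  have "Fs ! 0 \<in> set (take k Fs)" using k by (auto simp: in_set_conv_nth)
  then have "{} \<in> ?I" by (auto simp: generated_complex_def)
  moreover have "face_dim S = face_dim (Fs ! k) - 1" if S: "S \<in> facets ?I" for S
  proof -
    from S obtain j where j: "j < k" "S \<subseteq> Fs ! j" "S \<subseteq> Fs ! k"
      using k by (auto simp: facets_def generated_complex_def in_set_conv_nth)
    then obtain i x where i: "i < k" "x \<in> Fs ! k" "Fs ! j \<inter> Fs ! k \<subseteq> Fs ! k - {x}"
        "Fs ! k - {x} \<subseteq> Fs ! i"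
      using assms(1) k unfolding shelling_order_def by blast
    have "Fs ! i \<in> set (take k Fs)" using i(1) k by (auto simp: in_set_conv_nth)
    then have "Fs ! k - {x} \<in> ?I" using i(4) by (auto simp: generated_complex_def)
    moreover have "S \<subseteq> Fs ! k - {x}" using i(3) j by blast
    ultimately have "S = Fs ! k - {x}" using S by (auto simp: facets_def)
    moreover have "card (Fs ! k) > 0" using fin i(2) by (auto simp: card_gt_0_iff)
    ultimately show ?thesis using fin i(2) by (simp add: face_dim_def)
  qed
  ultimately show "pure_of_dim (face_dim (Fs ! k) - 1) ?I"
    unfolding pure_of_dim_def by auto
qed

definition has_shelling :: "'a set set \<Rightarrow> bool" where
  "has_shelling K \<longleftrightarrow> (\<exists>Fs. shelling_order Fs \<and> set Fs = facets K)"

lemma facetsI: "F \<in> K \<Longrightarrow> (\<And>F'. F' \<in> K \<Longrightarrow> F \<subseteq> F' \<Longrightarrow> F' = F) \<Longrightarrow> F \<in> facets K"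
  by (simp add: facets_def)

lemma facetsD1: "F \<in> facets K \<Longrightarrow> F \<in> K"
  by (simp add: facets_def)

lemma facetsD2: "F \<in> facets K \<Longrightarrow> F' \<in> K \<Longrightarrow> F \<subseteq> F' \<Longrightarrow> F' = F"
  by (simp add: facets_def)

lemma has_shelling_empty_face: "has_shelling {{} :: 'a set}"
proof -
  have "shelling_order [{} :: 'a set]" by (simp add: shelling_order_def)
  moreover have "facets {{} :: 'a set} = {{}}" by (simp add: facets_def)
  ultimately show ?thesis unfolding has_shelling_def by (intro exI[of _ "[{} :: 'a set]"]) simp
qed

lemma shelling_order_insert:
  assumes "shelling_order Fs" and v: "\<And>F. F \<in> set Fs \<Longrightarrow> v \<notin> F"
  shows "shelling_order (map (insert v) Fs)"
  unfolding shelling_order_def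
proof (intro conjI allI impI)
  have "inj_on (insert v) (set Fs)" using v by (metis inj_onI insert_ident)
  then show "distinct (map (insert v) Fs)"
    using assms(1) by (simp add: distinct_map shelling_order_def)
  fix k j assume "k < length (map (insert v) Fs)" and j: "j < k"
  then have k: "k < length Fs" by simp
  obtain i x where i: "i < k" "x \<in> Fs ! k" "Fs ! j \<inter> Fs ! k \<subseteq> Fs ! k - {x}"
      "Fs ! k - {x} \<subseteq> Fs ! i"
    using assms(1) k j unfolding shelling_order_def by blast
  have "x \<noteq> v" using i(2) v[OF nth_mem[OF k]] by blast
  then have "insert v (Fs ! j) \<inter> insert v (Fs ! k) \<subseteq> insert v (Fs ! k) - {x} \<and>
      insert v (Fs ! k) - {x} \<subseteq> insert v (Fs ! i)"
    using i(3,4) by blast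
  then show "\<exists>i<k. \<exists>x\<in>map (insert v) Fs ! k.
      map (insert v) Fs ! j \<inter> map (insert v) Fs ! k \<subseteq> map (insert v) Fs ! k - {x} \<and>
      map (insert v) Fs ! k - {x} \<subseteq> map (insert v) Fs ! i"
    using i(1,2) j k by (intro exI[of _ i] conjI bexI[of _ x]) simp_all
qed

lemma insert_facets_Un:
  assumes "X \<in> facets L" "\<And>F. F \<in> D \<union> L \<Longrightarrow> v \<notin> F"
  shows "insert v X \<in> facets (D \<union> insert v ` L)"
proof (rule facetsI)
  show "insert v X \<in> D \<union> insert v ` L" using assms(1) by (auto dest: facetsD1)
  fix Y assume Y: "Y \<in> D \<union> insert v ` L" "insert v X \<subseteq> Y"
  then obtain F where F: "F \<in> L" "Y = insert v F" using assms(2) by blast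
  have "v \<notin> X" using assms facetsD1 by blast
  then have "X \<subseteq> F" using Y(2) F(2) by blast
  then show "Y = insert v X" using facetsD2[OF assms(1) F(1)] F(2) by simp
qed

lemma facets_Un_insertD:
  assumes "insert v F \<in> facets (D \<union> insert v ` L)" "F \<in> L" "\<And>F. F \<in> L \<Longrightarrow> v \<notin> F"
  shows "F \<in> facets L"
proof (rule facetsI)
  show "F \<in> L" by fact
  fix F' assume F': "F' \<in> L" "F \<subseteq> F'"
  then have "insert v F' = insert v F" by (intro facetsD2[OF assms(1)]) auto
  then show "F' = F" using assms(2,3) F'(1) by (metis insert_ident)
qed

lemma has_shelling_cone:
  assumes "has_shelling K" and v: "\<And>F. F \<in> K \<Longrightarrow> v \<notin> F"
  shows "has_shelling (K \<union> insert v ` K)"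
proof -
  obtain Fs where Fs: "shelling_order Fs" "set Fs = facets K"
    using assms(1) by (auto simp: has_shelling_def)
  have "facets (K \<union> insert v ` K) = insert v ` facets K" (is "?L = ?R")
  proof (intro set_eqI iffI)
    fix X assume X: "X \<in> ?L"
    then obtain F where F: "F \<in> K" "X = F \<or> X = insert v F" by (auto dest: facetsD1)
    then have XF: "X = insert v F" using facetsD2[OF X, of "insert v F"] by blast
    then show "X \<in> ?R" using facets_Un_insertD[of v F K K] X F v by blast
  next
    fix X assume "X \<in> ?R"
    then show "X \<in> ?L" using insert_facets_Un[of _ K K v] v by blast
  qed
  moreover have "shelling_order (map (insert v) Fs)"
    using shelling_order_insert[OF Fs(1)] Fs(2) v facetsD1 by blast
  ultimately show ?thesis unfolding has_shelling_def
    using Fs(2) by (intro exI[of _ "map (insert v) Fs"]) simp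
qed

lemma face_subset_facet:
  assumes "finite K" "A \<in> K"
  obtains F where "F \<in> facets K" "A \<subseteq> F"
proof -
  obtain F where "F \<in> K" "A \<subseteq> F" "\<And>F'. F' \<in> K \<Longrightarrow> F \<subseteq> F' \<Longrightarrow> F' = F"
    using finite_has_maximal2[OF assms] by metis
  then show ?thesis using that facetsI by blast
qed

text \<open>By \<open>shed\<close> no face of the link is a facet of the deletion, so the facets of
  the union are those of \<open>D\<close> and the coned ones of \<open>L\<close>. They are listed in
  this order.\<close>

lemma has_shelling_shed:
  assumes "has_shelling D" "has_shelling L" "finite D" "L \<subseteq> D"
    and v: "\<And>F. F \<in> D \<Longrightarrow> v \<notin> F"
    and shed: "\<And>F. F \<in> L \<Longrightarrow> \<exists>w. w \<notin> F \<and> insert w F \<in> D"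
  shows "has_shelling (D \<union> insert v ` L)"
proof -
  obtain Fs where Fs: "shelling_order Fs" "set Fs = facets D"
    using assms(1) by (auto simp: has_shelling_def)
  obtain Gs where Gs: "shelling_order Gs" "set Gs = facets L"
    using assms(2) by (auto simp: has_shelling_def)
  have vL: "v \<notin> F" if "F \<in> L" for F using that v assms(4) by blast
  have facet: "facets (D \<union> insert v ` L) = facets D \<union> insert v ` facets L" (is "?A = ?B")
  proof (intro set_eqI iffI)
    fix X assume X: "X \<in> ?A"
    show "X \<in> ?B"
    proof (cases "X \<in> D")
      case True
      then have "X \<in> facets D" using facetsD2[OF X] by (intro facetsI) auto
      then show ?thesis by blast
    next
      case False
      then obtain F where "F \<in> L" "X = insert v F" using facetsD1[OF X] by blast
      then show ?thesis using facets_Un_insertD[of v F D L] X vL by blast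
    qed
  next
    fix X assume "X \<in> ?B"
    then consider "X \<in> facets D" | F where "F \<in> facets L" "X = insert v F" by blast
    then show "X \<in> ?A"
    proof cases
      case 1
      have False if F: "F \<in> L" "X \<subseteq> insert v F" for F
      proof -
        have "X \<subseteq> F" using F(2) v facetsD1[OF 1] by blast
        then have "F = X" using facetsD2[OF 1] F(1) assms(4) by blast
        then obtain w where "w \<notin> X" "insert w X \<in> D" using shed F(1) by blast
        then show False using facetsD2[OF 1, of "insert w X"] by blast
      qed
      then show ?thesis using facetsD1[OF 1] facetsD2[OF 1] by (intro facetsI) blast+
    next
      case 2
      then show ?thesis using insert_facets_Un[of F L D v] v vL by blast
    qed
  qed
  let ?Hs = "map (insert v) Gs"
  have Hs: "shelling_order ?Hs" 
    by (rule shelling_order_insert) (use Gs vL facetsD1 in blast)+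
  have order: "shelling_order (Fs @ ?Hs)"
    unfolding shelling_order_def
  proof (intro conjI allI impI)
    have "set Fs \<inter> set ?Hs = {}" using Fs(2) v facetsD1 by fastforce
    then show "distinct (Fs @ ?Hs)"
      using Fs(1) Hs by (simp add: shelling_order_def)
    fix k j assume kl: "k < length (Fs @ ?Hs)" and j: "j < k"
    show "\<exists>i<k. \<exists>x\<in>(Fs @ ?Hs) ! k. (Fs @ ?Hs) ! j \<inter> (Fs @ ?Hs) ! k \<subseteq> (Fs @ ?Hs) ! k - {x} \<and>
        (Fs @ ?Hs) ! k - {x} \<subseteq> (Fs @ ?Hs) ! i"
    proof (cases "k < length Fs")
      case True
      then obtain i x where "i < k" "x \<in> Fs ! k" "Fs ! j \<inter> Fs ! k \<subseteq> Fs ! k - {x}"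
          "Fs ! k - {x} \<subseteq> Fs ! i"
        using Fs(1) j unfolding shelling_order_def by blast
      then show ?thesis using True j
        by (intro exI[of _ i] conjI bexI[of _ x]) (simp_all add: nth_append)
    next
      case False
      then obtain k' where k': "k = length Fs + k'" using le_Suc_ex not_less by blast
      then have k'l: "k' < length Gs" using kl by simp
      have Gk: "Gs ! k' \<in> L" "v \<notin> Gs ! k'" using k'l Gs(2) vL facetsD1 nth_mem by blast+
      show ?thesis
      proof (cases "j < length Fs")
        case True
        \<comment> \<open>Against a facet of \<open>D\<close>, which misses \<open>v\<close>, the
          vertex to drop is \<open>v\<close>: the rest is a face of \<open>L \<subseteq> D\<close>
          and so lies in a facet of \<open>D\<close>, all of which come first.\<close>
        obtain F where "F \<in> facets D" "Gs ! k' \<subseteq> F"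
          using face_subset_facet assms(3,4) Gk(1) by blast
        then obtain i where i: "i < length Fs" "Gs ! k' \<subseteq> Fs ! i"
          using Fs(2) by (metis in_set_conv_nth)
        have "v \<notin> Fs ! j" using v[OF facetsD1] True Fs(2) nth_mem by blast
        then have "Fs ! j \<inter> insert v (Gs ! k') \<subseteq> insert v (Gs ! k') - {v} \<and>
            insert v (Gs ! k') - {v} \<subseteq> Fs ! i"
          using i Gk by blast
        then show ?thesis using i(1) k' k'l True
          by (intro exI[of _ i] conjI bexI[of _ v]) (simp_all add: nth_append)
      next
        case False
        then obtain j' where j': "j = length Fs + j'" using le_Suc_ex not_less by blast
        then have "k' < length ?Hs" "j' < k'" using k' k'l j by simp_all
        then obtain i x where "i < k'" "x \<in> ?Hs ! k'" "?Hs ! j' \<inter> ?Hs ! k' \<subseteq> ?Hs ! k' - {x}"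
          "?Hs ! k' - {x} \<subseteq> ?Hs ! i"
          using Hs unfolding shelling_order_def by blast
        then show ?thesis using k' j'
          by (intro exI[of _ "length Fs + i"] conjI bexI[of _ x]) simp_all
      qed
    qed
  qed
  have "set (Fs @ ?Hs) = facets (D \<union> insert v ` L)" using facet Fs(2) Gs(2) by simp
  then show ?thesis using order unfolding has_shelling_def by blast
qed

section \<open>Complexes of bounded component size\<close>

text \<open>Outside \<open>A\<close> the component is the junk value \<open>{x}\<close>.\<close>

definition comp_of :: "('a \<times> 'a) set \<Rightarrow> 'a set \<Rightarrow> 'a \<Rightarrow> 'a set" where
  "comp_of E A x = {y. (x, y) \<in> (E \<inter> A \<times> A)\<^sup>*}"

lemma comp_of_self: "x \<in> comp_of E A x"
  by (simp add: comp_of_def)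

lemma comp_of_step:
  "y \<in> comp_of E A x \<Longrightarrow> (y, z) \<in> E \<Longrightarrow> y \<in> A \<Longrightarrow> z \<in> A \<Longrightarrow> z \<in> comp_of E A x"
  unfolding comp_of_def by (auto intro: rtrancl_into_rtrancl)

lemma comp_of_adj: "(x, y) \<in> E \<Longrightarrow> x \<in> A \<Longrightarrow> y \<in> A \<Longrightarrow> y \<in> comp_of E A x"
  by (rule comp_of_step[OF comp_of_self])

lemma comp_of_closed:
  assumes "x \<in> T" "\<And>y z. y \<in> T \<Longrightarrow> y \<in> A \<Longrightarrow> z \<in> A \<Longrightarrow> (y, z) \<in> E \<Longrightarrow> z \<in> T"
  shows "comp_of E A x \<subseteq> T"
proof
  fix y assume "y \<in> comp_of E A x"
  then have "(x, y) \<in> (E \<inter> A \<times> A)\<^sup>*" by (simp add: comp_of_def)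
  then show "y \<in> T" by induction (use assms in auto)
qed

lemma comp_of_mono: "A \<subseteq> B \<Longrightarrow> comp_of E A x \<subseteq> comp_of E B x"
  unfolding comp_of_def using rtrancl_mono[of "E \<inter> A \<times> A" "E \<inter> B \<times> B"] by blast

lemma comp_of_subset: "x \<in> A \<Longrightarrow> comp_of E A x \<subseteq> A"
  by (rule comp_of_closed) auto

lemma finite_comp_of: "finite A \<Longrightarrow> finite (comp_of E A x)"
  by (rule finite_subset[OF comp_of_closed[of x "insert x A"]]) auto

lemma comp_of_eq:
  assumes "sym E" "y \<in> comp_of E A x"
  shows "comp_of E A y = comp_of E A x"
proof -
  have "sym ((E \<inter> A \<times> A)\<^sup>*)" by (rule sym_rtrancl) (use assms(1) in \<open>auto simp: sym_def\<close>)
  then show ?thesis using assms(2) unfolding comp_of_def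
    by (auto dest: symD intro: rtrancl_trans)
qed

lemma comp_of_exit:
  assumes "x \<in> T" "\<not> comp_of E A x \<subseteq> T"
  obtains y w where "y \<in> T" "y \<in> comp_of E A x" "w \<in> comp_of E A x" "w \<notin> T" "(y, w) \<in> E"
    "y \<in> A" "w \<in> A"
proof -
  have "\<not> comp_of E A x \<subseteq> T \<inter> comp_of E A x" using assms(2) by blast
  then have "\<exists>y z. y \<in> T \<inter> comp_of E A x \<and> y \<in> A \<and> z \<in> A \<and> (y, z) \<in> E \<and>
      z \<notin> T \<inter> comp_of E A x"
    using comp_of_closed[of x "T \<inter> comp_of E A x" A E] assms(1) comp_of_self[of x E A] by blast
  then show ?thesis using that comp_of_step by (metis IntI Int_iff)
qed

definition small_comps :: "nat \<Rightarrow> ('a \<times> 'a) set \<Rightarrow> 'a set \<Rightarrow> bool" where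
  "small_comps r E A \<longleftrightarrow> (\<forall>x \<in> A. card (comp_of E A x) \<le> r)"

lemma small_comps_mono:
  assumes "small_comps r E B" "A \<subseteq> B" "finite B"
  shows "small_comps r E A"
  unfolding small_comps_def
proof
  fix x assume "x \<in> A"
  then have "card (comp_of E B x) \<le> r" using assms by (auto simp: small_comps_def)
  moreover have "card (comp_of E A x) \<le> card (comp_of E B x)"
    by (intro card_mono finite_comp_of comp_of_mono assms)
  ultimately show "card (comp_of E A x) \<le> r" by simp
qed

text \<open>Only the component of \<open>w\<close> can grow: a component that avoids
  \<open>w\<close> lies in an old one.\<close>

lemma small_comps_insert:
  assumes "sym E" "finite A" "small_comps r E A" "card (comp_of E (insert w A) w) \<le> r"
  shows "small_comps r E (insert w A)"
  unfolding small_comps_def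
proof
  fix x assume x: "x \<in> insert w A"
  show "card (comp_of E (insert w A) x) \<le> r"
  proof (cases "w \<in> comp_of E (insert w A) x")
    case True
    then show ?thesis using comp_of_eq[OF assms(1) True] assms(4) by simp
  next
    case False
    then have "x \<in> A" using x comp_of_self by fastforce
    have "comp_of E (insert w A) x \<subseteq> comp_of E (insert w A) x \<inter> comp_of E A x"
    proof (rule comp_of_closed)
      show "x \<in> comp_of E (insert w A) x \<inter> comp_of E A x" by (simp add: comp_of_self)
      fix y z assume y: "y \<in> comp_of E (insert w A) x \<inter> comp_of E A x" and
        *: "y \<in> insert w A" "z \<in> insert w A" "(y, z) \<in> E"
      then have z: "z \<in> comp_of E (insert w A) x" using comp_of_step by fast
      then have "y \<in> A" "z \<in> A" using * y False by auto
      then show "z \<in> comp_of E (insert w A) x \<inter> comp_of E A x"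
        using z y *(3) comp_of_step by fast
    qed
    then have "card (comp_of E (insert w A) x) \<le> card (comp_of E A x)"
      by (intro card_mono finite_comp_of assms(2)) blast
    also have "\<dots> \<le> r" using \<open>x \<in> A\<close> assms(3) by (simp add: small_comps_def)
    finally show ?thesis .
  qed
qed

lemma small_comps_exchange:
  assumes "sym E" "finite B" "small_comps r E (insert v B)" "v \<notin> B" "w \<notin> B"
    and nbr: "\<And>z. z \<in> B \<Longrightarrow> (w, z) \<in> E \<Longrightarrow> z \<in> comp_of E (insert v B) v"
  shows "small_comps r E (insert w B)"
proof (rule small_comps_insert[OF assms(1,2)])
  show "small_comps r E B" using small_comps_mono[OF assms(3)] assms(2) by blast
  let ?T = "comp_of E (insert v B) v"
  have fin: "finite ?T" using assms(2) by (simp add: finite_comp_of)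
  have "comp_of E (insert w B) w \<subseteq> insert w (?T - {v})"
  proof (rule comp_of_closed)
    fix y z assume yz: "y \<in> insert w (?T - {v})" "y \<in> insert w B" "z \<in> insert w B" "(y, z) \<in> E"
    show "z \<in> insert w (?T - {v})"
    proof (cases "z = w")
      case False
      then have z: "z \<in> B" "z \<noteq> v" using yz(3) assms(4) by auto
      show ?thesis
      proof (cases "y = w")
        case True
        then show ?thesis using nbr z yz(4) by blast
      next
        case False
        then show ?thesis using comp_of_step[of y E "insert v B" v z] yz z by blast
      qed
    qed simp
  qed simp
  then have "card (comp_of E (insert w B) w) \<le> card (insert w (?T - {v}))"
    using fin by (intro card_mono) auto
  also have "\<dots> \<le> Suc (card (?T - {v}))" using fin by (simp add: card_insert_if)
  also have "\<dots> = card ?T" using fin comp_of_self by (intro card.remove[symmetric]) auto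
  also have "\<dots> \<le> r" using assms(3) by (simp add: small_comps_def)
  finally show "card (comp_of E (insert w B) w) \<le> r" .
qed

text \<open>The faces on \<open>V\<close> of the link of \<open>S\<close>. The links and deletions met while shedding vertices
  all have this form.\<close>

definition minor :: "nat \<Rightarrow> ('a \<times> 'a) set \<Rightarrow> 'a set \<Rightarrow> 'a set \<Rightarrow> 'a set set" where
  "minor r E S V = {A. A \<subseteq> V \<and> small_comps r E (A \<union> S)}"

text \<open>Vacuously true if \<open>v\<close> is in no face, in which case the minor does not change when \<open>v\<close> is
  deleted.\<close>

definition sheds :: "nat \<Rightarrow> ('a \<times> 'a) set \<Rightarrow> 'a set \<Rightarrow> 'a set \<Rightarrow> 'a \<Rightarrow> bool" where
  "sheds r E S V v \<longleftrightarrow> (\<forall>A \<subseteq> V - {v}. small_comps r E (insert v (A \<union> S)) \<longrightarrow>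
     (\<exists>w \<in> V - {v} - A. small_comps r E (insert w (A \<union> S))))"

section \<open>Deletion, link and shelling of minors\<close>

lemma minor_split:
  assumes "v \<in> V" "finite (S \<union> V)"
  shows "minor r E S V = minor r E S (V - {v}) \<union> insert v ` minor r E (insert v S) (V - {v})"
proof (intro set_eqI iffI)
  fix A assume A: "A \<in> minor r E S V"
  show "A \<in> minor r E S (V - {v}) \<union> insert v ` minor r E (insert v S) (V - {v})"
  proof (cases "v \<in> A")
    case True
    then have eq: "(A - {v}) \<union> insert v S = A \<union> S" by blast
    then have "A - {v} \<in> minor r E (insert v S) (V - {v})" using A by (auto simp: minor_def)
    moreover have "A = insert v (A - {v})" using True by blast
    ultimately show ?thesis by blast
  qed (use A in \<open>auto simp: minor_def\<close>)
next
  fix A assume "A \<in> minor r E S (V - {v}) \<union> insert v ` minor r E (insert v S) (V - {v})"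
  then show "A \<in> minor r E S V" using assms(1) by (auto simp: minor_def)
qed

text \<open>The bound on the component of \<open>v\<close> in all of \<open>S \<union> V\<close>
  lets \<open>v\<close> join every face, so link and deletion agree.\<close>

lemma has_shelling_minor_cone:
  assumes "sym E" "finite (S \<union> V)" "v \<in> V" "card (comp_of E (S \<union> V) v) \<le> r"
    and "has_shelling (minor r E S (V - {v}))"
  shows "has_shelling (minor r E S V)"
proof -
  have "minor r E (insert v S) (V - {v}) = minor r E S (V - {v})"
  proof (intro set_eqI iffI)
    fix A assume "A \<in> minor r E (insert v S) (V - {v})"
    then have A: "A \<subseteq> V - {v}" "small_comps r E (A \<union> insert v S)" by (auto simp: minor_def)
    have "finite (A \<union> insert v S)" using A(1) assms(2) finite_subset by auto
    then have "small_comps r E (A \<union> S)" using small_comps_mono[OF A(2)] by blast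
    then show "A \<in> minor r E S (V - {v})" using A by (auto simp: minor_def)
  next
    fix A assume "A \<in> minor r E S (V - {v})"
    then have A: "A \<subseteq> V - {v}" "small_comps r E (A \<union> S)" by (auto simp: minor_def)
    have "card (comp_of E (insert v (A \<union> S)) v) \<le> card (comp_of E (S \<union> V) v)"
      by (intro card_mono finite_comp_of comp_of_mono assms(2)) (use A(1) assms(3) in blast)
    moreover have "finite (A \<union> S)" using A(1) assms(2) finite_subset by auto
    ultimately have "small_comps r E (insert v (A \<union> S))"
      using small_comps_insert[OF assms(1) _ A(2)] assms(4) by simp
    then show "A \<in> minor r E (insert v S) (V - {v})" using A by (auto simp: minor_def)
  qed
  then have "minor r E S V = minor r E S (V - {v}) \<union> insert v ` minor r E S (V - {v})"
    using minor_split[OF assms(3,2), of r E] by simp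
  then show ?thesis using has_shelling_cone[OF assms(5), of v] by (auto simp: minor_def)
qed

lemma has_shelling_minor_shed:
  assumes "finite (S \<union> V)" "v \<in> V" "sheds r E S V v"
    and "has_shelling (minor r E S (V - {v}))"
    and "small_comps r E (insert v S) \<Longrightarrow> has_shelling (minor r E (insert v S) (V - {v}))"
  shows "has_shelling (minor r E S V)"
proof -
  let ?D = "minor r E S (V - {v})" and ?L = "minor r E (insert v S) (V - {v})"
  have fin: "finite (A \<union> insert v S)" if "A \<subseteq> V - {v}" for A
    using that assms(1) finite_subset by auto
  show ?thesis
  proof (cases "small_comps r E (insert v S)")
    case True
    have "has_shelling (?D \<union> insert v ` ?L)"
    proof (rule has_shelling_shed)
      show "has_shelling ?D" "has_shelling ?L" using assms(4,5) True by auto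
      have "?D \<subseteq> Pow V" by (auto simp: minor_def)
      then show "finite ?D" using assms(1) finite_subset by auto
      show "?L \<subseteq> ?D"
      proof
        fix A assume "A \<in> ?L"
        then have A: "A \<subseteq> V - {v}" "small_comps r E (A \<union> insert v S)" by (auto simp: minor_def)
        have "small_comps r E (A \<union> S)" using small_comps_mono[OF A(2) _ fin[OF A(1)]] by blast
        then show "A \<in> ?D" using A by (auto simp: minor_def)
      qed
      show "v \<notin> F" if "F \<in> ?D" for F using that by (auto simp: minor_def)
      show "\<exists>w. w \<notin> F \<and> insert w F \<in> ?D" if F: "F \<in> ?L" for F
      proof -
        have F': "F \<subseteq> V - {v}" "small_comps r E (insert v (F \<union> S))"
          using F by (auto simp: minor_def)
        then obtain w where "w \<in> V - {v} - F" "small_comps r E (insert w (F \<union> S))"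
          using assms(3) unfolding sheds_def by meson
        then show ?thesis using F'(1) by (intro exI[of _ w]) (auto simp: minor_def)
      qed
    qed
    then show ?thesis using minor_split[OF assms(2,1), of r E] by simp
  next
    case False
    \<comment> \<open>Here \<open>v\<close> lies in no face, so the link is empty and the minor is
      its own deletion.\<close>
    have False if "A \<subseteq> V - {v}" "small_comps r E (A \<union> insert v S)" for A
      using False small_comps_mono[OF that(2) _ fin[OF that(1)]] by blast
    then have "?L = {}" unfolding minor_def by blast
    then show ?thesis using minor_split[OF assms(2,1), of r E] assms(4) by simp
  qed
qed

section \<open>Vertex decomposition of double stars\<close>

text \<open>\<open>a\<close> and \<open>b\<close> are the roots, \<open>C\<close> their children, and \<open>L\<close> the children of those; \<open>par\<close> is
  unspecified at the roots.\<close>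

locale double_star =
  fixes r :: nat and E :: "('a \<times> 'a) set" and a b :: 'a and C L :: "'a set" and par :: "'a \<Rightarrow> 'a"
  assumes r_pos: "1 \<le> r"
    and finite_CL: "finite (C \<union> L)"
    and a_neq_b: "a \<noteq> b"
    and roots: "a \<notin> C \<union> L" "b \<notin> C \<union> L"
    and disj_CL: "C \<inter> L = {}"
    and par_C: "c \<in> C \<Longrightarrow> par c \<in> {a, b}"
    and par_L: "x \<in> L \<Longrightarrow> par x \<in> C"
    and E_iff: "(u, v) \<in> E \<longleftrightarrow> u = a \<and> v = b \<or> u = b \<and> v = a \<or>
      u \<in> C \<union> L \<and> v = par u \<or> v \<in> C \<union> L \<and> u = par v"
begin

lemma swap: "double_star r E b a C L par"
proof
  show "par c \<in> {b, a}" if "c \<in> C" for c using par_C[OF that] by blast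
  show "(u, v) \<in> E \<longleftrightarrow> u = b \<and> v = a \<or> u = a \<and> v = b \<or>
      u \<in> C \<union> L \<and> v = par u \<or> v \<in> C \<union> L \<and> u = par v" for u v
    using E_iff[of u v] by blast
qed (use r_pos finite_CL a_neq_b roots disj_CL par_L in simp_all)

lemma sym_E: "sym E"
  unfolding sym_def E_iff by blast

lemma nbr_L: "x \<in> L \<Longrightarrow> (x, z) \<in> E \<longleftrightarrow> z = par x"
  using E_iff[of x z] roots disj_CL par_C par_L by blast

lemma nbr_C: "c \<in> C \<Longrightarrow> (c, z) \<in> E \<longleftrightarrow> z = par c \<or> z \<in> L \<and> par z = c"
  using E_iff[of c z] roots disj_CL par_C by blast

lemma nbr_b: "(b, z) \<in> E \<longleftrightarrow> z = a \<or> z \<in> C \<and> par z = b"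
  using E_iff[of b z] roots a_neq_b par_L by blast

lemma nbr_a: "(a, z) \<in> E \<longleftrightarrow> z = b \<or> z \<in> C \<and> par z = a"
  using E_iff[of a z] roots a_neq_b par_L by blast

definition leaves :: "'a set \<Rightarrow> 'a \<Rightarrow> 'a set" where
  "leaves V c = {x \<in> V \<inter> L. par x = c}"

text \<open>The second condition makes a root shed as soon as one of its children is contracted.\<close>

definition valid :: "'a set \<Rightarrow> 'a set \<Rightarrow> bool" where
  "valid S V \<longleftrightarrow> (\<forall>x \<in> S \<inter> L. par x \<notin> V) \<and>
     (\<forall>c \<in> S \<inter> C. par c \<in> V \<longrightarrow> r \<le> card (leaves V c))"

lemma leaves_del: "v \<notin> L \<or> par v \<noteq> c \<Longrightarrow> leaves (V - {v}) c = leaves V c"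
  by (auto simp: leaves_def)

text \<open>Deleting a leaf lowers the count of its parent alone, which matters only when that
  parent is contracted and its root remains.\<close>

lemma valid_del:
  assumes "valid S V" "v \<in> L \<Longrightarrow> par v \<notin> S \<or> par (par v) \<notin> V"
  shows "valid S (V - {v})"
  unfolding valid_def
proof (intro conjI ballI impI)
  show "par x \<notin> V - {v}" if "x \<in> S \<inter> L" for x using that assms(1) by (auto simp: valid_def)
  fix c assume c: "c \<in> S \<inter> C" "par c \<in> V - {v}"
  then have "leaves (V - {v}) c = leaves V c" using assms(2) by (intro leaves_del) auto
  then show "r \<le> card (leaves (V - {v}) c)" using c assms(1) by (auto simp: valid_def)
qed

lemma valid_link:
  assumes "valid S V" "v \<in> L \<Longrightarrow> par v \<notin> V" "v \<in> L \<Longrightarrow> par v \<notin> S \<or> par (par v) \<notin> V"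
    and "v \<in> C \<Longrightarrow> par v \<in> V \<Longrightarrow> r \<le> card (leaves V v)"
  shows "valid (insert v S) (V - {v})"
proof -
  have "valid S (V - {v})" using valid_del assms(1,3) by blast
  moreover have "leaves (V - {v}) v = leaves V v" if "v \<in> C"
    using that disj_CL by (intro leaves_del) blast
  ultimately show ?thesis using assms(2,4) unfolding valid_def by auto
qed

text \<open>The local step of the induction. A cone point needs only a valid deletion, because its
  link is the same complex.\<close>

definition good :: "'a set \<Rightarrow> 'a set \<Rightarrow> 'a \<Rightarrow> bool" where
  "good S V v \<longleftrightarrow> v \<in> V \<and> valid S (V - {v}) \<and>
     (card (comp_of E (S \<union> V) v) \<le> r \<or> sheds r E S V v \<and> valid (insert v S) (V - {v}))"

end

locale double_star_minor = double_star +
  fixes S V :: "'a set"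
  assumes SV: "S \<union> V \<subseteq> {a, b} \<union> C \<union> L" and disj: "S \<inter> V = {}" and valid: "valid S V"
begin

lemma swap_minor: "double_star_minor r E b a C L par S V"
proof -
  interpret sw: double_star r E b a C L par by (rule swap)
  have "sw.valid S V = valid S V" unfolding valid_def sw.valid_def leaves_def sw.leaves_def ..
  then show ?thesis using SV disj valid by unfold_locales auto
qed

lemma finite_SV: "finite (S \<union> V)"
  by (rule finite_subset[OF SV]) (use finite_CL in simp)

lemma finite_V: "finite V"
  using finite_SV by auto

lemma leaf_S: "x \<in> S \<Longrightarrow> x \<in> L \<Longrightarrow> par x \<notin> V"
  using valid by (auto simp: valid_def)

lemma finite_leaves: "A \<subseteq> V \<Longrightarrow> finite (leaves A c)"
  using finite_V by (auto simp: leaves_def intro: finite_subset[of _ V])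

text \<open>The component of \<open>x\<close> in \<open>B0\<close> is too large for a face, so the component of \<open>v\<close> in a face can be
  left along an edge \<open>y w\<close> inside \<open>B0\<close>.\<close>

lemma sheds_at_exit:
  assumes v: "v \<in> V" and x: "\<And>A. A \<subseteq> V - {v} \<Longrightarrow> x \<in> comp_of E (insert v (A \<union> S)) v"
    and B0: "B0 \<subseteq> S \<union> V" "x \<in> B0" and big: "r < card (comp_of E B0 x)"
    and ok: "\<And>A y w. A \<subseteq> V - {v} \<Longrightarrow> small_comps r E (insert v (A \<union> S)) \<Longrightarrow>
      y \<in> comp_of E (insert v (A \<union> S)) v \<Longrightarrow> y \<in> comp_of E B0 x \<Longrightarrow> y \<in> B0 \<Longrightarrow>
      w \<in> comp_of E B0 x \<Longrightarrow> w \<in> B0 \<Longrightarrow> w \<in> V - {v} - A \<Longrightarrow> (y, w) \<in> E \<Longrightarrow>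
      w \<notin> comp_of E (insert v (A \<union> S)) v \<Longrightarrow> w \<notin> A \<union> S \<Longrightarrow> \<exists>w' \<in> V - {v} - A. small_comps r E (insert w' (A \<union> S))"
  shows "sheds r E S V v"
  unfolding sheds_def
proof (intro allI impI)
  fix A assume A: "A \<subseteq> V - {v}" and sm: "small_comps r E (insert v (A \<union> S))"
  let ?B = "A \<union> S" let ?T = "comp_of E (insert v ?B) v"
  have fin: "finite ?B" using A finite_SV finite_subset by auto
  have T: "?T \<subseteq> insert v ?B" by (rule comp_of_subset) simp
  have "card ?T \<le> r" using sm by (simp add: small_comps_def)
  have "\<not> comp_of E B0 x \<subseteq> ?T"
  proof
    assume "comp_of E B0 x \<subseteq> ?T"
    then have "card (comp_of E B0 x) \<le> card ?T"
      using fin by (intro card_mono finite_comp_of) simp_all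
    then show False using big \<open>card ?T \<le> r\<close> by simp
  qed
  then obtain y w where yw: "y \<in> ?T" "y \<in> comp_of E B0 x" "w \<in> comp_of E B0 x" "w \<notin> ?T"
      "(y, w) \<in> E" "y \<in> B0" "w \<in> B0"
    using comp_of_exit[OF x[OF A]] by metis
  have "w \<notin> insert v ?B" using comp_of_step[OF yw(1,5)] yw(1,4) T by blast
  then have "w \<in> V - {v} - A" "w \<notin> ?B" using B0(1) yw(7) by auto
  then show "\<exists>w\<in>V - {v} - A. small_comps r E (insert w ?B)"
    using ok[OF A sm] yw by blast
qed

text \<open>Every exit vertex can be added in place of \<open>v\<close>, since its component is
  small even in all of \<open>S \<union> V - {v}\<close>. Exits are sought only within
  \<open>B0\<close>, so a part of the tree outside \<open>B0\<close> need not be controlled.\<close>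

lemma sheds_if_splits:
  assumes v: "v \<in> V" and B0: "B0 \<subseteq> S \<union> V" "v \<in> B0" and big: "r < card (comp_of E B0 v)"
    and small: "\<And>w. w \<in> comp_of E B0 v \<Longrightarrow> w \<noteq> v \<Longrightarrow> card (comp_of E (S \<union> V - {v}) w) \<le> r"
  shows "sheds r E S V v"
proof (rule sheds_at_exit[OF v comp_of_self B0 big])
  fix A y w assume A: "A \<subseteq> V - {v}" and sm: "small_comps r E (insert v (A \<union> S))"
    and w: "w \<in> comp_of E B0 v" "w \<in> V - {v} - A"
  have fin: "finite (A \<union> S)" using A finite_SV finite_subset by auto
  have "comp_of E (insert w (A \<union> S)) w \<subseteq> comp_of E (S \<union> V - {v}) w"
    by (rule comp_of_mono) (use A w v disj in blast)
  then have "card (comp_of E (insert w (A \<union> S)) w) \<le> card (comp_of E (S \<union> V - {v}) w)"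
    by (intro card_mono finite_comp_of) (use finite_SV in auto)
  also have "\<dots> \<le> r" using small w by blast
  finally have "small_comps r E (insert w (A \<union> S))"
    using small_comps_insert[OF sym_E fin] small_comps_mono[OF sm] fin by blast
  then show "\<exists>w' \<in> V - {v} - A. small_comps r E (insert w' (A \<union> S))" using w by blast
qed

text \<open>The component of \<open>v\<close> contains \<open>c\<close> and its leaves in
  \<open>A\<close>. These cannot be all the leaves of \<open>c\<close>, and a missing one can
  replace \<open>v\<close>.\<close>

lemma sheds_if_many_leaves:
  assumes v: "v \<in> V" and c: "c \<in> C" "c \<in> insert v S" "c \<noteq> v \<Longrightarrow> (v, c) \<in> E"
    and big: "r \<le> card (leaves V c)" and vL: "v \<notin> L"
  shows "sheds r E S V v"
  unfolding sheds_def
proof (intro allI impI)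
  fix A assume A: "A \<subseteq> V - {v}" and sm: "small_comps r E (insert v (A \<union> S))"
  let ?B = "A \<union> S" let ?T = "comp_of E (insert v ?B) v"
  have fin: "finite ?B" using A finite_SV finite_subset by auto
  have cT: "c \<in> ?T" using c comp_of_self comp_of_adj[of v c E] by (cases "c = v") auto
  have "insert c (leaves A c) \<subseteq> ?T"
    using cT c comp_of_step[OF cT] nbr_C[OF c(1)] by (auto simp: leaves_def)
  then have "card (insert c (leaves A c)) \<le> card ?T"
    using fin by (intro card_mono finite_comp_of) auto
  also have "\<dots> \<le> r" using sm by (simp add: small_comps_def)
  finally have "card (insert c (leaves A c)) \<le> r" .
  moreover have "c \<notin> leaves A c" using c disj_CL by (auto simp: leaves_def)
  moreover have finA: "finite (leaves A c)" using A by (intro finite_leaves) blast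
  \<comment> \<open>The inequality is strict because \<open>c\<close> itself takes one of the
    \<open>r\<close> places.\<close>
  ultimately have "card (leaves A c) < r" by simp
  then have "\<not> leaves V c \<subseteq> leaves A c"
    using big card_mono[OF finA, of "leaves V c"] by linarith
  then obtain w where w: "w \<in> V" "w \<in> L" "par w = c" "w \<notin> A" by (auto simp: leaves_def)
  have "small_comps r E (insert w ?B)"
    by (rule small_comps_exchange[OF sym_E fin sm]) (use w A v disj cT nbr_L in auto)
  then show "\<exists>w\<in>V - {v} - A. small_comps r E (insert w ?B)" using w vL by blast
qed

text \<open>A leaf meets the rest only in its parent, so the exchange condition concerns the parent
  alone and is vacuous when the parent is absent.\<close>

lemma exchange_leaf:
  assumes A: "A \<subseteq> V - {v}" and v: "v \<in> V" and sm: "small_comps r E (insert v (A \<union> S))"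
    and w: "w \<in> V - {v} - A" "w \<in> L" and par: "par w \<in> A \<union> S \<Longrightarrow> par w \<in> comp_of E (insert v (A \<union> S)) v"
  shows "\<exists>w' \<in> V - {v} - A. small_comps r E (insert w' (A \<union> S))"
proof -
  have fin: "finite (A \<union> S)" using A finite_SV finite_subset by auto
  have "small_comps r E (insert w (A \<union> S))"
    by (rule small_comps_exchange[OF sym_E fin sm]) (use w A v disj par nbr_L in auto)
  then show ?thesis using w by blast
qed

text \<open>If the component of \<open>c\<close> in a face is left through another child of a contracted root, that
  child can replace \<open>c\<close> because it carries at most as many leaves.\<close>

lemma sheds_max_child:
  assumes c: "c \<in> V" "c \<in> C" "par c \<in> S"
    and max: "\<And>d. d \<in> V \<Longrightarrow> d \<in> C \<Longrightarrow> par d \<in> S \<Longrightarrow> card (leaves V d) \<le> card (leaves V c)"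
    and big: "r < card (comp_of E (S \<union> (V - {a, b})) c)"
  shows "sheds r E S V c"
proof (rule sheds_at_exit[OF c(1) comp_of_self _ _ big])
  show "S \<union> (V - {a, b}) \<subseteq> S \<union> V" by blast
  show "c \<in> S \<union> (V - {a, b})" using c roots by blast
  fix A y w
  let ?B = "A \<union> S" let ?T = "comp_of E (insert c ?B) c"
  assume A: "A \<subseteq> V - {c}" and sm: "small_comps r E (insert c ?B)" and y: "y \<in> ?T"
    "y \<in> S \<union> (V - {a, b})" and w: "w \<in> S \<union> (V - {a, b})" "w \<in> V - {c} - A" and yw: "(y, w) \<in> E"
    and wT: "w \<notin> ?T" and wB: "w \<notin> ?B"
  have fin: "finite ?B" using A finite_SV finite_subset by auto
  have TB: "?T \<subseteq> insert c ?B" by (rule comp_of_subset) simp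
  have wy: "(w, y) \<in> E" using yw sym_E by (meson symD)
  show "\<exists>w' \<in> V - {c} - A. small_comps r E (insert w' ?B)"
  proof (cases "leaves V c \<subseteq> A")
    case False
    \<comment> \<open>A leaf of \<open>c\<close> outside \<open>A\<close> replaces \<open>c\<close>.
      Afterwards all leaves of \<open>c\<close> may be assumed to lie in \<open>A\<close>.\<close>
    then obtain x where x: "x \<in> V" "x \<in> L" "par x = c" "x \<notin> A" by (auto simp: leaves_def)
    show ?thesis
      by (rule exchange_leaf[OF A c(1) sm, of x]) (use x c disj disj_CL comp_of_self in auto)
  next
    case leavesA: True
    have "w \<noteq> a" "w \<noteq> b" using w disj by auto
    then consider "w \<in> L" | "w \<in> C" using w SV by blast
    then show ?thesis
    proof cases
      case 1
      have "par w = y" using nbr_L[OF 1, of y] wy by simp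
      then show ?thesis using y(1) by (intro exchange_leaf[OF A c(1) sm w(2) 1]) simp
    next
      case 2
      have ypar: "y = par w"
      proof (rule ccontr)
        \<comment> \<open>With \<open>w\<close> absent, a leaf \<open>y\<close> of \<open>w\<close>
          would be isolated in \<open>insert c ?B\<close>, yet \<open>c\<close> lies in its
          component.\<close>
        assume "y \<noteq> par w"
        then have yL: "y \<in> L" "par y = w" using nbr_C[OF 2] wy by auto
        then have "comp_of E (insert c ?B) y \<subseteq> {y}"
          by (intro comp_of_closed) (use nbr_L w(2) wB in auto)
        moreover have "c \<in> comp_of E (insert c ?B) y"
          using comp_of_eq[OF sym_E y(1)] comp_of_self by fast
        ultimately show False using yL c(2) disj_CL by blast
      qed
      \<comment> \<open>The searched set contains no root of \<open>V\<close>, so the root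
        \<open>y\<close> is contracted and \<open>max\<close> applies to \<open>w\<close>.\<close>
      then have yS: "y \<in> S" and yr: "y \<in> {a, b}" using y(2) par_C[OF 2] by auto
      have le: "card (leaves V w) \<le> card (leaves V c)" using max[of w] 2 w(2) yS ypar by blast
      \<comment> \<open>\<open>?R\<close> is what the old component has outside the star of
        \<open>c\<close>. The star of \<open>w\<close> takes the place of that star and is no
        larger.\<close>
      let ?R = "?T - insert c (leaves V c)"
      have finT: "finite ?T" using fin by (simp add: finite_comp_of)
      have finV: "finite (leaves V d)" for d by (simp add: finite_leaves)
      have LAV: "leaves A w \<subseteq> leaves V w" using A by (auto simp: leaves_def)
      have finA: "finite (leaves A w)" by (rule finite_subset[OF LAV finV])
      have cl: "c \<notin> leaves V c" using c disj_CL by (auto simp: leaves_def)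
      have LT: "insert c (leaves V c) \<subseteq> ?T"
        using comp_of_self[of c E] comp_of_adj[of c _ E "insert c ?B"] nbr_C[OF c(2)] leavesA
        by (auto simp: leaves_def)
      have "comp_of E (insert w ?B) w \<subseteq> insert w (leaves A w) \<union> ?R"
      proof (rule comp_of_closed)
        fix t z assume t: "t \<in> insert w (leaves A w) \<union> ?R" and z: "z \<in> insert w ?B" "(t, z) \<in> E"
        have cB: "c \<notin> ?B" using A c disj by blast
        consider "t = w" | "t \<in> leaves A w" | "t \<in> ?R" using t by blast
        then show "z \<in> insert w (leaves A w) \<union> ?R"
        proof cases
          case 1
          then consider "z = y" | "z \<in> L" "par z = w" using nbr_C[OF 2] z ypar by auto
          then show ?thesis
          proof cases
            case 1
            then show ?thesis using y(1) yr roots c by (auto simp: leaves_def)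
          next
            case 2
            have "z \<noteq> w" using 2(1) \<open>w \<in> C\<close> disj_CL by blast
            moreover have "z \<notin> S" using leaf_S[of z] 2 w(2) by auto
            ultimately have "z \<in> A" using z(1) by simp
            then show ?thesis using 2 A by (auto simp: leaves_def)
          qed
        next
          case 2
          then show ?thesis using z nbr_L by (auto simp: leaves_def)
        next
          case 3
          show ?thesis
          proof (cases "z = w")
            case False
            then have zB: "z \<in> ?B" using z by blast
            have "z \<in> ?T" using comp_of_step[of t E "insert c ?B" c z] 3 z(2) zB TB by blast
            moreover have "z \<noteq> c" using zB cB by blast
            moreover have "z \<notin> leaves V c"
            proof
              assume "z \<in> leaves V c"
              then have "t = c" using z(2) nbr_L[of z t] sym_E by (auto simp: leaves_def dest: symD)
              then show False using 3 by blast
            qed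
            ultimately show ?thesis by blast
          qed simp
        qed
      qed simp
      then have "card (comp_of E (insert w ?B) w) \<le> card (insert w (leaves A w) \<union> ?R)"
        using finT finA by (intro card_mono) simp_all
      also have "\<dots> \<le> card (insert w (leaves A w)) + card ?R" by (rule card_Un_le)
      finally have 1: "card (comp_of E (insert w ?B) w) \<le> card (insert w (leaves A w)) + card ?R" .
      have 2: "card (insert w (leaves A w)) \<le> Suc (card (leaves V c))"
        using finA card_mono[OF finV LAV] le by (simp add: card_insert_if)
      have 3: "Suc (card (leaves V c)) + card ?R = card ?T"
        using card_Diff_subset[OF finite_subset[OF LT finT] LT] card_mono[OF finT LT] finV cl
        by simp
      have "card ?T \<le> r" using sm by (simp add: small_comps_def)
      then have card: "card (comp_of E (insert w ?B) w) \<le> r" using 1 2 3 by linarith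
      have "small_comps r E ?B" by (rule small_comps_mono[OF sm]) (use fin in auto)
      then have "small_comps r E (insert w ?B)" using small_comps_insert[OF sym_E fin] card by blast
      then show ?thesis using w by blast
    qed
  qed
qed

section \<open>Good vertices that can be found locally\<close>

lemma root_cases: "\<rho> \<in> {a, b} \<Longrightarrow> \<rho> \<notin> C \<and> \<rho> \<notin> L"
  using roots by blast

lemma good_root: "\<rho> \<in> {a, b} \<Longrightarrow> \<rho> \<in> V \<Longrightarrow>
    card (comp_of E (S \<union> V) \<rho>) \<le> r \<or> sheds r E S V \<rho> \<Longrightarrow> good S V \<rho>"
  unfolding good_def using valid_del[OF valid, of \<rho>] valid_link[OF valid, of \<rho>] root_cases by blast

lemma good_child: "c \<in> C \<Longrightarrow> c \<in> V \<Longrightarrow> sheds r E S V c \<Longrightarrow>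
    par c \<in> V \<longrightarrow> r \<le> card (leaves V c) \<Longrightarrow> good S V c"
  unfolding good_def using valid_del[OF valid, of c] valid_link[OF valid, of c] disj_CL by blast

lemma good_isolated_leaf:
  assumes "x \<in> V" "x \<in> L" "par x \<notin> S \<union> V"
  shows "good S V x"
proof -
  have "comp_of E (S \<union> V) x \<subseteq> {x}"
    by (rule comp_of_closed) (use assms nbr_L in auto)
  then have "comp_of E (S \<union> V) x = {x}" using comp_of_self[of x E] by blast
  then show ?thesis unfolding good_def using assms valid_del[OF valid] r_pos by simp
qed

lemma good_many_leaves:
  assumes "c \<in> V" "c \<in> C" "r \<le> card (leaves V c)"
  shows "good S V c"
  using good_child sheds_if_many_leaves[of c c] assms disj_CL by blast

lemma good_root_of_contracted:
  assumes "d \<in> S" "d \<in> C" "par d \<in> V"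
  shows "good S V (par d)"
proof -
  have "r \<le> card (leaves V d)" using valid assms by (auto simp: valid_def)
  moreover have "(par d, d) \<in> E" using E_iff[of "par d" d] assms(2) by blast
  ultimately have "sheds r E S V (par d)"
    using sheds_if_many_leaves[of "par d" d] assms root_cases[OF par_C[OF assms(2)]] by blast
  then show ?thesis using good_root[OF par_C[OF assms(2)]] assms(3) by blast
qed

text \<open>Without its root, a child is the centre of a star. Contracted leaves cannot enlarge the
  star, because the first clause of \<open>valid\<close> forbids them below a child in
  \<open>V\<close>.\<close>

lemma comp_of_child:
  assumes "c \<in> V" "c \<in> C" "par c \<notin> B" "B \<subseteq> S \<union> V"
  shows "comp_of E B c \<subseteq> insert c (leaves V c)"
proof (rule comp_of_closed)
  fix y z assume y: "y \<in> insert c (leaves V c)" and z: "z \<in> B" "(y, z) \<in> E"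
  show "z \<in> insert c (leaves V c)"
  proof (cases "y = c")
    case True
    then have "z \<in> L" "par z = c" using nbr_C[OF assms(2)] z assms(3) by auto
    moreover have "z \<in> V" using leaf_S[of z] calculation z(1) assms(1,4) by blast
    ultimately show ?thesis by (simp add: leaves_def)
  next
    case False
    then show ?thesis using y z nbr_L by (auto simp: leaves_def)
  qed
qed simp

lemma card_comp_of_child:
  assumes "c \<in> V" "c \<in> C" "par c \<notin> B" "B \<subseteq> S \<union> V" "card (leaves V c) < r"
  shows "card (comp_of E B c) \<le> r"
proof -
  have fin: "finite (leaves V c)" by (simp add: finite_leaves)
  then have "card (comp_of E B c) \<le> card (insert c (leaves V c))"
    using comp_of_child[OF assms(1-4)] by (intro card_mono) auto
  also have "\<dots> \<le> Suc (card (leaves V c))" using fin by (simp add: card_insert_if)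
  finally show ?thesis using assms(5) by simp
qed

lemma good_orphan_child:
  assumes "c \<in> V" "c \<in> C" "par c \<notin> S \<union> V" "card (leaves V c) < r"
  shows "good S V c"
  using card_comp_of_child[of c "S \<union> V"] valid_del[OF valid, of c] assms disj_CL
  unfolding good_def by blast

end

text \<open>No vertex is good for a local reason: the assumptions deny, in this order, the cases of
  \<open>good_isolated_leaf\<close>, \<open>good_many_leaves\<close>,
  \<open>good_root_of_contracted\<close> and \<open>good_orphan_child\<close>.\<close>

locale double_star_reduced = double_star_minor +
  assumes leaf_par: "\<And>x. x \<in> V \<Longrightarrow> x \<in> L \<Longrightarrow> par x \<in> S \<union> V"
    and few_leaves: "\<And>c. c \<in> V \<Longrightarrow> c \<in> C \<Longrightarrow> card (leaves V c) < r"
    and child_S: "\<And>c. c \<in> S \<Longrightarrow> c \<in> C \<Longrightarrow> par c \<notin> V"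
    and child_par: "\<And>c. c \<in> V \<Longrightarrow> c \<in> C \<Longrightarrow> par c \<in> S \<union> V"
begin

lemma swap_reduced: "double_star_reduced r E b a C L par S V"
proof -
  interpret sw: double_star_minor r E b a C L par S V by (rule swap_minor)
  show ?thesis
    by unfold_locales (use leaf_par few_leaves child_S child_par in auto)
qed

text \<open>By \<open>child_S\<close> the children below \<open>\<rho>\<close> are not contracted,
  and by \<open>few_leaves\<close> each of them spans a star with at most \<open>r\<close> vertices
  once \<open>\<rho>\<close> is gone.\<close>

lemma branch_small:
  assumes "\<rho> \<in> V" "\<rho> \<in> {a, b}" "w \<in> S \<union> V" "w \<in> C \<and> par w = \<rho> \<or> w \<in> L \<and> par (par w) = \<rho>"
  shows "card (comp_of E (S \<union> V - {\<rho>}) w) \<le> r"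
proof -
  have child: "card (comp_of E (S \<union> V - {\<rho>}) c) \<le> r" if "c \<in> S \<union> V" "c \<in> C" "par c = \<rho>" for c
  proof -
    have "c \<in> V" using that child_S assms(1) by blast
    then show ?thesis using card_comp_of_child[of c "S \<union> V - {\<rho>}"] few_leaves that by blast
  qed
  show ?thesis
  proof (cases "w \<in> C")
    case True
    then show ?thesis using child assms(3,4) disj_CL by blast
  next
    case False
    then have w: "w \<in> L" "par (par w) = \<rho>" using assms(4) by auto
    have ne: "w \<noteq> \<rho>" "par w \<noteq> \<rho>" using w par_L roots assms(2) by auto
    show ?thesis
    proof (cases "par w \<in> S \<union> V")
      case True
      then have "par w \<in> comp_of E (S \<union> V - {\<rho>}) w"
        using nbr_L[OF w(1)] assms(3) ne by (intro comp_of_adj) auto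
      then show ?thesis using comp_of_eq[OF sym_E] child[OF True par_L[OF w(1)] w(2)] by simp
    next
      case False
      \<comment> \<open>By \<open>leaf_par\<close> this can only be a contracted leaf whose parent
        is no longer in \<open>S \<union> V\<close>.\<close>
      then have "comp_of E (S \<union> V - {\<rho>}) w \<subseteq> {w}"
        by (intro comp_of_closed) (use nbr_L[OF w(1)] in auto)
      then have "comp_of E (S \<union> V - {\<rho>}) w = {w}" using comp_of_self[of w E] by blast
      then show ?thesis using r_pos by simp
    qed
  qed
qed

definition branch :: "'a \<Rightarrow> 'a set" where
  "branch \<rho> = {w. w \<in> C \<and> par w = \<rho> \<or> w \<in> L \<and> par (par w) = \<rho>}"

lemma branch_step:
  assumes "y \<in> branch \<rho>" "(y, z) \<in> E"
  shows "z = \<rho> \<or> z \<in> branch \<rho>"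
proof (cases "y \<in> L")
  case True
  then have "z = par y" "par y \<in> C" using nbr_L assms(2) par_L by auto
  then show ?thesis using assms(1) True disj_CL by (auto simp: branch_def)
next
  case False
  then have "y \<in> C" "par y = \<rho>" using assms(1) by (auto simp: branch_def)
  then show ?thesis using nbr_C assms(2) by (auto simp: branch_def)
qed

text \<open>Unless \<open>b\<close> is a cone point, deleting it splits its component into small
  pieces of its branch and the component of \<open>a\<close>, so \<open>sheds_if_splits\<close>
  applies with all of \<open>S \<union> V\<close>.\<close>

lemma good_b_if_small:
  assumes b: "b \<in> V" and a: "a \<in> S \<union> V \<Longrightarrow> card (comp_of E (S \<union> V - {b}) a) \<le> r"
  shows "good S V b"
proof (cases "card (comp_of E (S \<union> V) b) \<le> r")
  case False
  \<comment> \<open>The guard makes \<open>?A\<close> empty when \<open>a\<close> is absent, where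
    \<open>comp_of\<close> would return the junk value \<open>{a}\<close>.\<close>
  let ?A = "{z. a \<in> S \<union> V \<and> z \<in> comp_of E (S \<union> V - {b}) a}"
  have sub: "comp_of E (S \<union> V) b \<subseteq> insert b (branch b \<union> ?A)"
  proof (rule comp_of_closed)
    fix y z assume y: "y \<in> insert b (branch b \<union> ?A)" "y \<in> S \<union> V" and z: "z \<in> S \<union> V" "(y, z) \<in> E"
    consider "y = b" | "y \<in> branch b" | "y \<noteq> b" "y \<in> ?A" using y by blast
    then show "z \<in> insert b (branch b \<union> ?A)"
    proof cases
      case 1
      then show ?thesis using nbr_b[of z] z comp_of_self[of a E] by (auto simp: branch_def)
    next
      case 2
      then show ?thesis using branch_step z by blast
    next
      case 3
      then show ?thesis using comp_of_step[of y E "S \<union> V - {b}" a z] y(2) z by blast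
    qed
  qed simp
  have "sheds r E S V b"
  proof (rule sheds_if_splits[OF b])
    show "S \<union> V \<subseteq> S \<union> V" "b \<in> S \<union> V" using b by auto
    show "r < card (comp_of E (S \<union> V) b)" using False by simp
    fix w assume w: "w \<in> comp_of E (S \<union> V) b" "w \<noteq> b"
    then have "w \<in> S \<union> V" using comp_of_subset[of b "S \<union> V" E] b by blast
    moreover have "w \<in> branch b \<or> w \<in> ?A" using sub w by blast
    ultimately show "card (comp_of E (S \<union> V - {b}) w) \<le> r"
      using branch_small[OF b, of w] comp_of_eq[OF sym_E, of w "S \<union> V - {b}" a] a
      by (auto simp: branch_def)
  qed
  then show ?thesis using good_root b by blast
qed (use good_root b in blast)

text \<open>Without \<open>b\<close>, the large component of \<open>a\<close> consists of
  \<open>a\<close> and part of its branch. Exits sought there become small once \<open>a\<close> is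
  deleted, whatever happens on the side of \<open>b\<close>.\<close>

lemma good_a_if_big:
  assumes "a \<in> V" and big: "r < card (comp_of E (S \<union> V - {b}) a)"
  shows "good S V a"
proof -
  have sub: "comp_of E (S \<union> V - {b}) a \<subseteq> insert a (branch a)"
  proof (rule comp_of_closed)
    fix y z assume y: "y \<in> insert a (branch a)" and z: "z \<in> S \<union> V - {b}" "(y, z) \<in> E"
    then show "z \<in> insert a (branch a)"
      using nbr_a[of z] branch_step[of y a z] by (auto simp: branch_def)
  qed simp
  have "sheds r E S V a"
  proof (rule sheds_if_splits[OF assms(1) _ _ big])
    show aB: "a \<in> S \<union> V - {b}" using assms(1) a_neq_b by blast
    fix w assume w: "w \<in> comp_of E (S \<union> V - {b}) a" "w \<noteq> a"
    then have "w \<in> S \<union> V" "w \<in> branch a" using comp_of_subset[OF aB, of E] sub by auto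
    then show "card (comp_of E (S \<union> V - {a}) w) \<le> r"
      using branch_small[OF assms(1), of w] by (auto simp: branch_def)
  qed blast
  then show ?thesis using good_root assms by blast
qed

text \<open>The size condition is left inside the conclusion: with \<open>b\<close> in
  \<open>V\<close> it is inherited from the component of \<open>a\<close>, and with no root in
  \<open>V\<close> its failure makes \<open>c\<close> a cone point.\<close>

lemma good_max_child:
  assumes "{c \<in> V \<inter> C. par c \<in> S} \<noteq> {}"
  obtains c where "c \<in> V" "c \<in> C" "par c \<in> S"
    "r < card (comp_of E (S \<union> (V - {a, b})) c) \<Longrightarrow> good S V c"
proof -
  let ?Q = "{c \<in> V \<inter> C. par c \<in> S}"
  have "finite ?Q" using finite_V by simp
  then obtain c where c: "c \<in> ?Q" "\<And>d. d \<in> ?Q \<Longrightarrow> card (leaves V d) \<le> card (leaves V c)"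
    using assms obtains_MAX[of ?Q "\<lambda>c. card (leaves V c)"] by (metis (lifting) Max_ge finite_imageI image_eqI)
  have "good S V c" if "r < card (comp_of E (S \<union> (V - {a, b})) c)"
  proof (rule good_child)
    show "sheds r E S V c" by (rule sheds_max_child) (use c that in auto)
  qed (use c disj in auto)
  then show ?thesis using that c(1) by blast
qed

text \<open>The contracted root \<open>a\<close> always lies in the component of \<open>b\<close>,
  so exits are sought from \<open>a\<close>. With no child of \<open>a\<close> left in
  \<open>V\<close>, only leaves can be exits.\<close>

lemma good_b_leaf_exit:
  assumes b: "b \<in> V" and a: "a \<in> S" and big: "r < card (comp_of E (S \<union> V - {b}) a)"
    and Q: "{c \<in> V \<inter> C. par c \<in> S} = {}"
  shows "good S V b"
proof -
  have "sheds r E S V b"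
  proof (rule sheds_at_exit[OF b _ _ _ big])
    have ba: "(b, a) \<in> E" by (simp add: nbr_b)
    show aT: "a \<in> comp_of E (insert b (A \<union> S)) b" for A
      using comp_of_adj[OF ba] a by blast
    show aB: "a \<in> S \<union> V - {b}" using a a_neq_b by blast
    fix A y w
    let ?T = "comp_of E (insert b (A \<union> S)) b"
    assume A: "A \<subseteq> V - {b}" and sm: "small_comps r E (insert b (A \<union> S))" and y: "y \<in> ?T"
      "y \<in> S \<union> V - {b}" and w: "w \<in> V - {b} - A" and yw: "(y, w) \<in> E"
      and wT: "w \<notin> ?T" and wB: "w \<notin> A \<union> S"
    have wy: "(w, y) \<in> E" using yw sym_E by (meson symD)
    have "w \<notin> C"
    proof
      assume wC: "w \<in> C"
      have "par w \<noteq> a" using Q w a wC by blast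
      \<comment> \<open>As \<open>b\<close> is outside the searched set, a child of \<open>b\<close>
        could only be reached from one of its own leaves. Such a leaf would be all of
        \<open>?T\<close>, which contains \<open>b\<close>.\<close>
      then have "par w = b" using par_C wC by blast
      then have yL: "y \<in> L" "par y = w" using nbr_C[OF wC] wy y(2) by auto
      then have "comp_of E (insert b (A \<union> S)) y \<subseteq> {y}"
        by (intro comp_of_closed) (use nbr_L w wB in auto)
      then have "?T \<subseteq> {y}" using comp_of_eq[OF sym_E y(1)] by blast
      then show False using comp_of_self[of b E] y(2) by blast
    qed
    moreover have "w \<noteq> a" using aT wT by blast
    ultimately have "w \<in> L" using SV w by blast
    then show "\<exists>w'\<in>V - {b} - A. small_comps r E (insert w' (A \<union> S))"
      using nbr_L[of w y] wy y(1) by (intro exchange_leaf[OF A b sm w]) auto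
  qed blast
  then show ?thesis using good_root b by blast
qed

text \<open>The component of \<open>a\<close> in \<open>S \<union> V - {b}\<close> decides. If it is
  small or \<open>a\<close> is absent, \<open>b\<close> is good; if it is large, it supplies the
  exits for \<open>a\<close>, for a child of \<open>a\<close>, or for \<open>b\<close>.\<close>

lemma exists_good_b:
  assumes b: "b \<in> V"
  shows "\<exists>v. good S V v"
proof (cases "a \<in> S \<union> V \<longrightarrow> card (comp_of E (S \<union> V - {b}) a) \<le> r")
  case True
  then show ?thesis using good_b_if_small b by blast
next
  case False
  then have big: "r < card (comp_of E (S \<union> V - {b}) a)" and "a \<in> S \<union> V" by auto
  then consider "a \<in> V" | "a \<in> S" by blast
  then show ?thesis
  proof cases
    case 1
    then show ?thesis using good_a_if_big big by blast
  next
    case 2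
    show ?thesis
    proof (cases "{c \<in> V \<inter> C. par c \<in> S} = {}")
      case True
      then show ?thesis using good_b_leaf_exit[OF b 2 big] by blast
    next
      case False
      then obtain c where c: "c \<in> V" "c \<in> C" "par c \<in> S"
        "r < card (comp_of E (S \<union> (V - {a, b})) c) \<Longrightarrow> good S V c"
        using good_max_child by blast
      have eq: "S \<union> (V - {a, b}) = S \<union> V - {b}" using 2 b disj a_neq_b by auto
      \<comment> \<open>Since \<open>b\<close> is still in \<open>V\<close>, the contracted root of
        \<open>c\<close> is \<open>a\<close>, and the component of \<open>c\<close> is the large one
        of \<open>a\<close>.\<close>
      have "par c = a" using c(3) b disj par_C[OF c(2)] by auto
      then have "a \<in> comp_of E (S \<union> V - {b}) c"
        using nbr_C[OF c(2)] c 2 a_neq_b roots by (intro comp_of_adj) auto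
      then have "comp_of E (S \<union> V - {b}) c = comp_of E (S \<union> V - {b}) a"
        using comp_of_eq[OF sym_E] by metis
      then show ?thesis using c(4) big eq by auto
    qed
  qed
qed

text \<open>A child left in \<open>V\<close> hangs from a contracted root, and one with most leaves
  is good. Otherwise \<open>V\<close> consists of leaves of contracted children, so every exit
  vertex is a leaf and can be exchanged.\<close>

lemma exists_good_no_root:
  assumes ab: "a \<notin> V" "b \<notin> V" and "V \<noteq> {}"
  shows "\<exists>v. good S V v"
proof (cases "{c \<in> V \<inter> C. par c \<in> S} = {}")
  case False
  then obtain c where c: "c \<in> V" "c \<in> C" "par c \<in> S"
    "r < card (comp_of E (S \<union> (V - {a, b})) c) \<Longrightarrow> good S V c"
    using good_max_child by blast
  have "V - {a, b} = V" using ab by blast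
  then show ?thesis using c valid_del[OF valid, of c] disj_CL unfolding good_def
    by (metis IntI empty_iff not_le)
next
  case True
  have VL: "V \<subseteq> L"
  proof
    fix v assume v: "v \<in> V"
    have "par v \<notin> V" if "v \<in> C" using par_C[OF that] ab by blast
    then have "v \<notin> C" using True v child_par by blast
    then show "v \<in> L" using v SV ab by auto
  qed
  obtain x where x: "x \<in> V" using assms(3) by blast
  have xL: "x \<in> L" and px: "par x \<in> S" "par x \<notin> V" "par (par x) \<notin> V"
    using x VL leaf_par[of x] par_L[of x] par_C[of "par x"] ab disj_CL by auto
  have "card (comp_of E (S \<union> V) x) \<le> r \<or> sheds r E S V x"
  proof (cases "card (comp_of E (S \<union> V) x) \<le> r")
    case False
    have "sheds r E S V x"
    proof (rule sheds_at_exit[OF x comp_of_self])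
      show "r < card (comp_of E (S \<union> V) x)" using False by simp
      fix A y w
      assume A: "A \<subseteq> V - {x}" and sm: "small_comps r E (insert x (A \<union> S))"
        and y: "y \<in> comp_of E (insert x (A \<union> S)) x" and w: "w \<in> V - {x} - A" and yw: "(y, w) \<in> E"
      have wL: "w \<in> L" using w VL by blast
      have "par w = y" using nbr_L[OF wL, of y] yw sym_E by (auto dest: symD)
      then show "\<exists>w'\<in>V - {x} - A. small_comps r E (insert w' (A \<union> S))"
        using y by (intro exchange_leaf[OF A x sm w wL]) simp
    qed (use x in auto)
    then show ?thesis by blast
  qed blast
  \<comment> \<open>The parent of \<open>x\<close> is contracted, but no root is left in
    \<open>V\<close>, so \<open>valid\<close> no longer bounds its number of leaves.\<close>
  moreover have "valid S (V - {x})" using valid_del[OF valid] px by blast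
  moreover have "valid (insert x S) (V - {x})" using valid_link[OF valid] px xL disj_CL by blast
  ultimately show ?thesis unfolding good_def using x by blast
qed

lemma exists_good_reduced:
  assumes "V \<noteq> {}"
  shows "\<exists>v. good S V v"
proof -
  interpret sw: double_star_reduced r E b a C L par S V by (rule swap_reduced)
  show ?thesis using exists_good_b sw.exists_good_b exists_good_no_root[OF _ _ assms] by blast
qed

end

lemma (in double_star_minor) exists_good:
  assumes "V \<noteq> {}"
  shows "\<exists>v. good S V v"
proof (rule ccontr)
  assume no: "\<not> ?thesis"
  interpret double_star_reduced r E a b C L par S V
  proof
    show "par x \<in> S \<union> V" if "x \<in> V" "x \<in> L" for x
      using no good_isolated_leaf that by blast
    show few: "card (leaves V c) < r" if "c \<in> V" "c \<in> C" for c
      using no good_many_leaves that not_less by blast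
    show "par c \<notin> V" if "c \<in> S" "c \<in> C" for c
      using no good_root_of_contracted that by blast
    show "par c \<in> S \<union> V" if "c \<in> V" "c \<in> C" for c
      using no good_orphan_child that few by blast
  qed
  show False using exists_good_reduced[OF assms] no by blast
qed

section \<open>Induction on the number of undecided vertices\<close>

context double_star
begin

text \<open>The premise \<open>small_comps r E S\<close> makes the empty set a face, so the
  induction ends at \<open>{{}}\<close>. Accordingly the link is visited only when
  \<open>insert v S\<close> satisfies it as well.\<close>

lemma has_shelling_minor:
  assumes "S \<union> V \<subseteq> {a, b} \<union> C \<union> L" "S \<inter> V = {}" "valid S V" "small_comps r E S"
  shows "has_shelling (minor r E S V)"
  using assms
proof (induction "card V" arbitrary: S V rule: less_induct)
  case less
  interpret double_star_minor r E a b C L par S V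
    using less.prems by unfold_locales auto
  show ?case
  proof (cases "V = {}")
    case True
    then have "minor r E S V = {{}}" using less.prems(4) by (auto simp: minor_def)
    then show ?thesis using has_shelling_empty_face by simp
  next
    case False
    then obtain v where v: "good S V v" using exists_good by blast
    then have vV: "v \<in> V" and vd: "valid S (V - {v})" by (auto simp: good_def)
    have less': "card (V - {v}) < card V" using finite_V vV by (rule card_Diff1_less)
    have del: "has_shelling (minor r E S (V - {v}))"
      by (rule less.hyps[OF less' _ _ vd less.prems(4)]) (use less.prems in auto)
    consider "card (comp_of E (S \<union> V) v) \<le> r" | "sheds r E S V v" "valid (insert v S) (V - {v})"
      using v by (auto simp: good_def)
    then show ?thesis
    proof cases
      case 1
      then show ?thesis using has_shelling_minor_cone[OF sym_E finite_SV vV _ del] by blast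
    next
      case 2
      have "has_shelling (minor r E (insert v S) (V - {v}))" if "small_comps r E (insert v S)"
        by (rule less.hyps[OF less' _ _ 2(2) that]) (use less.prems vV in auto)
      then show ?thesis using has_shelling_minor_shed[OF finite_SV vV 2(1) del] by blast
    qed
  qed
qed

lemma has_shelling_double_star:
  "has_shelling {A. A \<subseteq> {a, b} \<union> C \<union> L \<and> small_comps r E A}"
  using has_shelling_minor[of "{}" "{a, b} \<union> C \<union> L"]
  by (simp add: valid_def minor_def small_comps_def)

end

section \<open>Trees of diameter at most 5\<close>

definition spath :: "('a \<times> 'a) set \<Rightarrow> 'a list \<Rightarrow> bool" where
  "spath E xs \<longleftrightarrow> distinct xs \<and> successively (\<lambda>x y. (x, y) \<in> E) xs"

lemma spath_Cons:
  "spath E (x # xs) \<longleftrightarrow> x \<notin> set xs \<and> spath E xs \<and> (xs \<noteq> [] \<longrightarrow> (x, hd xs) \<in> E)"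
  by (cases xs) (auto simp: spath_def)

lemma spath_append:
  "spath E (xs @ ys) \<longleftrightarrow> spath E xs \<and> spath E ys \<and> set xs \<inter> set ys = {} \<and>
     (xs \<noteq> [] \<and> ys \<noteq> [] \<longrightarrow> (last xs, hd ys) \<in> E)"
  by (auto simp: spath_def successively_append_iff)

lemma spath_rev: "sym E \<Longrightarrow> spath E (rev xs) \<longleftrightarrow> spath E xs"
  unfolding spath_def successively_rev by (auto simp: sym_conv_converse_eq dest: symD
      elim!: successively_mono)

lemma spath_Nil [simp]: "spath E []"
  by (simp add: spath_def)

text \<open>The bound 3 sets aside the two ends of a single edge, which are adjacent in both
  directions.\<close>

locale acyclic_rel =
  fixes E :: "('a \<times> 'a) set"
  assumes sym: "sym E" and irrefl: "(x, x) \<notin> E"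
    and no_cycle: "3 \<le> length xs \<Longrightarrow> spath E xs \<Longrightarrow> (last xs, hd xs) \<notin> E"
begin

text \<open>Two paths that leave \<open>u\<close> by different edges and meet again close a cycle
  through \<open>u\<close>. Cutting \<open>xs\<close> at its first vertex on \<open>ys\<close> makes
  this cycle simple.\<close>

lemma spath_branch_disjoint:
  assumes "spath E (u # xs)" "spath E (u # ys)" "xs \<noteq> []" "ys \<noteq> []" "hd xs \<noteq> hd ys"
  shows "set xs \<inter> set ys = {}"
proof (rule ccontr)
  assume "set xs \<inter> set ys \<noteq> {}"
  then obtain p1 z p2 where xs: "xs = p1 @ z # p2" "z \<in> set ys" "\<forall>p \<in> set p1. p \<notin> set ys"
    using split_list_first_prop[of xs "\<lambda>z. z \<in> set ys"] by blast
  obtain q1 q2 where ys: "ys = q1 @ z # q2" using split_list[OF xs(2)] by blast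
  let ?c = "(u # p1 @ [z]) @ rev q1"
  have 1: "spath E (u # p1 @ [z])" using assms(1) unfolding xs 
    by (auto simp: spath_Cons spath_append hd_append split: if_splits)
  have 2: "spath E (q1 @ [z])" "u \<notin> set q1"
    using assms(2) unfolding ys by (simp_all add: spath_Cons spath_append)
  then have 3: "spath E ([z] @ rev q1)" using spath_rev[OF sym, of "q1 @ [z]"] by simp
  have "set (u # p1) \<inter> set q1 = {}" using 2(2) xs(3) ys by auto
  then have "spath E (u # p1) \<and> set (u # p1) \<inter> set ([z] @ rev q1) = {} \<and> (last (u # p1), z) \<in> E"
    using 1 spath_append[of E "u # p1" "[z]"] by auto
  then have "spath E ((u # p1) @ ([z] @ rev q1))" using 3 by (subst spath_append) simp
  then have "spath E ?c" by simp
  moreover have "3 \<le> length ?c"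
    using assms(5) xs(1) ys by (cases p1; cases q1) auto
  moreover have "last ?c = hd ys" unfolding ys by (cases q1) auto
  moreover have "(hd ys, u) \<in> E" using assms(2,4) sym by (auto simp: spath_Cons dest: symD)
  ultimately show False using no_cycle[of ?c] by simp
qed

text \<open>This identifies a simple path with a shortest walk between its ends and so turns the
  diameter bound into one for all simple paths.\<close>

lemma spath_unique:
  assumes "spath E p" "spath E q" "p \<noteq> []" "q \<noteq> []" "hd p = hd q" "last p = last q"
  shows "p = q"
  using assms
proof (induction p arbitrary: q)
  case (Cons u p)
  then obtain q' where q: "q = u # q'" by (cases q) auto
  show ?case
  proof (cases "p = [] \<or> q' = []")
    case True
    then show ?thesis using Cons.prems q by (auto simp: spath_Cons split: if_splits)
  next
    case False
    then have ends: "last p = last q'" "p \<noteq> []" "q' \<noteq> []" using Cons.prems q by auto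
    then have "last p \<in> set p \<inter> set q'" by (metis IntI last_in_set)
    then have "hd p = hd q'" using spath_branch_disjoint[of u p q'] Cons.prems q ends by blast
    then show ?thesis using Cons.IH[of q'] Cons.prems q ends by (auto simp: spath_Cons)
  qed
qed simp

end

text \<open>The length of a list counts vertices: 6 of them form a path with 5 edges.\<close>

locale short_tree = acyclic_rel +
  fixes V :: "'a set"
  assumes finite_V: "finite V" and E_V: "E \<subseteq> V \<times> V"
    and conn: "u \<in> V \<Longrightarrow> v \<in> V \<Longrightarrow> (u, v) \<in> E\<^sup>*"
    and short: "spath E xs \<Longrightarrow> length xs \<le> 6"
begin

lemma adjD: "(x, y) \<in> E \<Longrightarrow> (y, x) \<in> E \<and> x \<noteq> y \<and> x \<in> V \<and> y \<in> V"
  using sym irrefl E_V by (auto dest: symD)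

text \<open>A path of three edges leaving \<open>a\<close> away from \<open>b\<close> would extend the other half to a path longer
  than the longest one.\<close>

lemma centre_aux:
  assumes p: "spath E (rev ys @ a # b # xs)" and "length ys \<le> 2"
    and max: "\<And>q. spath E q \<Longrightarrow> length q \<le> length (rev ys @ a # b # xs)"
  shows "\<not> (c \<noteq> b \<and> spath E [a, c, v, w])"
proof
  assume c: "c \<noteq> b \<and> spath E [a, c, v, w]"
  have abx: "spath E (a # b # xs)" using p by (simp add: spath_append)
  then have "set [c, v, w] \<inter> set (b # xs) = {}"
    using spath_branch_disjoint[of a "[c, v, w]" "b # xs"] c by auto
  moreover have "spath E (rev [a, c, v, w])" using c spath_rev[OF sym] by blast
  then have "spath E [w, v, c]" "(c, a) \<in> E" "a \<notin> {c, v, w}" by (auto simp: spath_Cons)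
  ultimately have "spath E ([w, v, c] @ (a # b # xs))" using abx by (subst spath_append) auto
  from max[OF this] assms(2) show False by simp
qed

lemma centre:
  assumes "card V \<ge> 2"
  obtains a b where "(a, b) \<in> E" "\<And>c v w. \<not> (c \<noteq> b \<and> spath E [a, c, v, w])"
    "\<And>c v w. \<not> (c \<noteq> a \<and> spath E [b, c, v, w])"
proof -
  have "\<not> V \<subseteq> {x}" for x using assms card_mono[of "{x}" V] by auto
  then obtain u v where uv: "u \<in> V" "v \<in> V" "u \<noteq> v" by blast
  then obtain w where "(u, w) \<in> E" using conn[OF uv(1,2)] by (metis converse_rtranclE)
  then have uw: "spath E [u, w]" using adjD by (simp add: spath_def)
  have "\<forall>q. spath E q \<longrightarrow> length q < 7" using short by fastforce
  then have "\<exists>p. spath E p \<and> (\<forall>q. spath E q \<longrightarrow> length q \<le> length p)"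
    using ex_has_greatest_nat[of "spath E" "[u, w]" length 7] uw by blast
  then obtain p where p: "spath E p" and max: "\<And>q. spath E q \<Longrightarrow> length q \<le> length p" by blast
  \<comment> \<open>The edge from position \<open>?i\<close> to the next leaves at most two vertices
    on each side, as the path has at most six. On paths with fewer than four vertices the minimum
    keeps the edge inside the path.\<close>
  let ?m = "length p" let ?i = "min 2 (length p - 2)"
  have m: "2 \<le> ?m" "?m \<le> 6" using max[OF uw] short[OF p] by auto
  define a b where "a = p ! ?i" and "b = p ! Suc ?i"
  define ys xs where "ys = rev (take ?i p)" and "xs = drop (Suc (Suc ?i)) p"
  have split: "p = rev ys @ a # b # xs" unfolding ys_def xs_def a_def b_def
    using m by (simp add: Cons_nth_drop_Suc)
  have len: "length ys \<le> 2" "length xs \<le> 2" unfolding ys_def xs_def using m by auto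
  have "(a, b) \<in> E" using p unfolding split by (simp add: spath_append spath_Cons)
  moreover have "\<not> (c \<noteq> b \<and> spath E [a, c, v, w])" for c v w
    using centre_aux[of ys a b xs] p max len split by metis
  moreover have "rev p = rev xs @ b # a # ys" by (subst split) simp
  then have "\<not> (c \<noteq> a \<and> spath E [b, c, v, w])" for c v w
    using centre_aux[of xs b a ys] p max len spath_rev[OF sym, of p] by (metis length_rev)
  ultimately show ?thesis using that by blast
qed

text \<open>\<open>centre\<close> puts every vertex within distance two of \<open>{a, b}\<close>,
  and an edge outside the pattern of \<open>double_star\<close> would close a cycle.\<close>

lemma double_star_exists:
  assumes "card V \<ge> 2" "1 \<le> r"
  shows "\<exists>a b C L par. double_star r E a b C L par \<and> V = {a, b} \<union> C \<union> L"
proof -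
  obtain a b where ab: "(a, b) \<in> E" and far_a: "\<And>c v w. \<not> (c \<noteq> b \<and> spath E [a, c, v, w])"
    and far_b: "\<And>c v w. \<not> (c \<noteq> a \<and> spath E [b, c, v, w])"
    using centre[OF assms(1)] by metis
  note ba = adjD[OF ab]
  define C where "C = {c \<in> V - {a, b}. (a, c) \<in> E \<or> (b, c) \<in> E}"
  define L where "L = V - C - {a, b}"
  define par where "par v = (if v \<in> C then if (a, v) \<in> E then a else b
    else SOME c. c \<in> C \<and> (v, c) \<in> E)" for v
  have root: "par c \<in> {a, b}" "(c, par c) \<in> E" if "c \<in> C" for c
    using that adjD by (auto simp: par_def C_def)
  \<comment> \<open>Along a walk from \<open>a\<close>, the first vertex beyond the neighbours of
    \<open>C\<close> would end a path of three edges that leaves one root away from the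
    other.\<close>
  have cover: "v \<in> {a, b} \<union> C \<or> (\<exists>c \<in> C. (v, c) \<in> E)" if "v \<in> V" for v
  proof -
    have "(a, v) \<in> E\<^sup>*" using conn ba that by blast
    then show ?thesis
    proof induction
      case (step v w)
      note vw = adjD[OF step.hyps(2)]
      show ?case
      proof (cases "v \<in> {a, b} \<union> C \<or> w \<in> {a, b} \<union> C")
        case True
        then show ?thesis using step.hyps(2) vw by (auto simp: C_def)
      next
        case False
        then obtain c where c: "c \<in> C" "(v, c) \<in> E" using step.IH by blast
        then have "c \<noteq> w" "c \<noteq> v" "c \<notin> {a, b}" using False by (auto simp: C_def)
        then have "spath E [par c, c, v, w]" using False c root[OF c(1)] vw step.hyps(2) adjD
          by (auto simp: spath_def)
        then show ?thesis using root(1)[OF c(1)] far_a[of c v w] far_b[of c v w] \<open>c \<notin> {a, b}\<close> by auto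
      qed
    qed simp
  qed
  have par_L: "par x \<in> C" "(x, par x) \<in> E" if "x \<in> L" for x
    using cover[of x] that someI_ex[of "\<lambda>c. c \<in> C \<and> (x, c) \<in> E"] by (auto simp: par_def L_def)
  \<comment> \<open>Distinct children are joined through one or both roots. Most of the extra edges
    excluded below would close such a path to a cycle.\<close>
  have link: "\<exists>ms. ms \<noteq> [] \<and> set ms \<subseteq> {a, b} \<and> spath E (c # ms @ [c'])"
    if c: "c \<in> C" "c' \<in> C" "c \<noteq> c'" for c c'
  proof -
    have *: "c \<notin> {a, b}" "c' \<notin> {a, b}" "(par c', c') \<in> E"
      using c root(2)[of c'] adjD by (auto simp: C_def)
    show ?thesis
    proof (cases "par c = par c'")
      case True
      then show ?thesis using * c root[of c] root[of c'] adjD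
        by (intro exI[of _ "[par c]"]) (auto simp: spath_def)
    next
      case False
      then have "(par c, par c') \<in> E" using root(1)[OF c(1)] root(1)[OF c(2)] ab ba by auto
      then show ?thesis using * c root[of c] root[of c'] False
        by (intro exI[of _ "[par c, par c']"]) (auto simp: spath_def)
    qed
  qed
  have CC: "(c, c') \<notin> E" if c: "c \<in> C" "c' \<in> C" for c c'
  proof (cases "c = c'")
    case False
    then obtain ms where "ms \<noteq> []" "spath E (c # ms @ [c'])" using link[OF c] by blast
    then show ?thesis using no_cycle[of "c # ms @ [c']"] adjD by (cases ms) auto
  qed (use irrefl in simp)
  have LC: "par x = c" if x: "x \<in> L" "c \<in> C" "(x, c) \<in> E" for x c
  proof (rule ccontr)
    assume "par x \<noteq> c"
    then obtain ms where ms: "ms \<noteq> []" "set ms \<subseteq> {a, b}" "spath E (par x # ms @ [c])"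
      using link[OF par_L(1)[OF x(1)] x(2)] by blast
    have "spath E (x # par x # ms @ [c])"
      using ms par_L[OF x(1)] x by (subst spath_Cons) (auto simp: L_def)
    then show False using no_cycle[of "x # par x # ms @ [c]"] ms(1) x(3) adjD by (cases ms) auto
  qed
  have LL: "(x, y) \<notin> E" if x: "x \<in> L" "y \<in> L" for x y
  proof
    assume xy: "(x, y) \<in> E"
    note px = par_L[OF x(1)] and py = par_L[OF x(2)]
    have ne: "x \<notin> C" "y \<notin> C" "x \<notin> {a, b}" "y \<notin> {a, b}" "x \<noteq> y"
      using x adjD[OF xy] by (auto simp: L_def)
    show False
    proof (cases "par x = par y")
      case True
      then have "spath E [par x, x, y]" using px ne xy adjD[OF px(2)] by (auto simp: spath_def)
      then show False using no_cycle[of "[par x, x, y]"] py True by auto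
    next
      case False
      then obtain ms where ms: "ms \<noteq> []" "set ms \<subseteq> {a, b}" "spath E (par x # ms @ [par y])"
        using link px(1) py(1) by blast
      let ?q = "x # par x # ms @ [par y]"
      have "spath E ?q" using ms px py ne by (subst spath_Cons) auto
      moreover have "y \<notin> set ?q" using ms(2) px py ne by auto
      ultimately have "spath E (?q @ [y])"
        using adjD[OF py(2)] by (subst spath_append) (simp add: spath_Cons)
      then show False using no_cycle[of "?q @ [y]"] adjD[OF xy] by simp
    qed
  qed
  have "double_star r E a b C L par"
  proof
    show "1 \<le> r" by fact
    show "finite (C \<union> L)" using finite_V by (auto simp: C_def L_def)
    show "a \<noteq> b" using ba by blast
    show "a \<notin> C \<union> L" "b \<notin> C \<union> L" "C \<inter> L = {}" by (auto simp: C_def L_def)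
    show "par c \<in> {a, b}" if "c \<in> C" for c using root that by blast
    show "par x \<in> C" if "x \<in> L" for x using par_L that by blast
    \<comment> \<open>\<open>par\<close> prefers \<open>a\<close>, so a common neighbour of the two
      roots has to be excluded.\<close>
    have tri: "(a, c) \<notin> E" if "(b, c) \<in> E" for c
      using no_cycle[of "[a, b, c]"] that ab ba adjD[OF that] adjD[of a c] by (auto simp: spath_def)
    have up: "u = b \<and> v = a \<or> u \<in> C \<union> L \<and> v = par u"
      if uv: "(u, v) \<in> E" and "v \<in> {a, b} \<and> (u, v) \<noteq> (a, b) \<or> u \<in> L" for u v
    proof (cases "u \<in> L")
      case True
      have "v \<notin> {a, b}" using True uv adjD[OF uv] by (auto simp: L_def C_def)
      then show ?thesis using True uv LC LL adjD[OF uv] by (auto simp: L_def)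
    next
      case False
      then have v: "v \<in> {a, b}" "(u, v) \<noteq> (a, b)" using that by auto
      show ?thesis
      proof (cases "u \<in> {a, b}")
        case False
        then have "u \<in> C" "(v, u) \<in> E" using v adjD[OF uv] by (auto simp: C_def)
        then show ?thesis using v(1) tri[of u] by (auto simp: par_def)
      qed (use v adjD[OF uv] in auto)
    qed
    show "(u, v) \<in> E \<longleftrightarrow> u = a \<and> v = b \<or> u = b \<and> v = a \<or>
      u \<in> C \<union> L \<and> v = par u \<or> v \<in> C \<union> L \<and> u = par v" for u v
    proof
      assume uv: "(u, v) \<in> E"
      show "u = a \<and> v = b \<or> u = b \<and> v = a \<or>
        u \<in> C \<union> L \<and> v = par u \<or> v \<in> C \<union> L \<and> u = par v"
      proof (cases "(u, v) = (a, b) \<or> (v, u) = (a, b)")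
        case False
        have "v \<in> {a, b} \<or> u \<in> L \<or> u \<in> {a, b} \<or> v \<in> L"
          using CC[of u v] uv adjD[OF uv] by (auto simp: L_def)
        then show ?thesis using up[OF uv] up[of v u] adjD[OF uv] False by auto
      qed auto
    qed (use ab ba root(2) par_L(2) adjD in blast)
  qed
  moreover have "V = {a, b} \<union> C \<union> L" using ba by (auto simp: C_def L_def)
  ultimately show ?thesis by blast
qed

end

section \<open>Transfer to library graphs\<close>

lemma (in wf_digraph) awalk_of_successively:
  assumes "successively (\<lambda>x y. (x, y) \<in> arcs_ends G) xs" "xs \<noteq> []" "hd xs \<in> verts G"
  shows "\<exists>p. awalk (hd xs) p (last xs) \<and> awalk_verts (hd xs) p = xs"
  using assms
proof (induction xs rule: induct_list012)
  case (2 x)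
  then show ?case by (intro exI[of _ "[]"]) (simp add: awalk_Nil_iff)
next
  case (3 x y zs)
  then have "(x, y) \<in> arcs_ends G" by simp
  then obtain e where e: "e \<in> arcs G" "tail G e = x" "head G e = y" by (elim reachableE)
  then obtain p where "awalk y p (last (y # zs))" "awalk_verts y p = y # zs"
    using 3 head_in_verts[OF e(1)] by auto
  then show ?case using e by (intro exI[of _ "e # p"]) (auto simp: awalk_Cons_iff)
qed simp

lemma (in wf_digraph) successively_awalk_verts:
  "awalk u p v \<Longrightarrow> successively (\<lambda>x y. (x, y) \<in> arcs_ends G) (awalk_verts u p)"
proof (induction p arbitrary: u)
  case (Cons e p)
  then have e: "e \<in> arcs G" "awalk (head G e) p v" by (simp_all add: awalk_Cons_iff)
  then have "hd (awalk_verts (head G e) p) = head G e" by auto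
  moreover have "(tail G e, head G e) \<in> arcs_ends G" using e(1) by (auto simp: arcs_ends_conv)
  ultimately show ?case using Cons.IH[OF e(2)] by (simp add: successively_Cons)
qed simp

lemma (in wf_digraph) awalk_cost_unit: "awalk_cost (\<lambda>_. 1) p = real (length p)"
  by (induction p) simp_all

lemma connected_imp_reachable:
  assumes "graph G" "connected G" "u \<in> verts G" "v \<in> verts G"
  shows "u \<rightarrow>\<^sup>*\<^bsub>G\<^esub> v"
proof -
  interpret graph G by fact
  show ?thesis using assms(2-4) reachable_mk_symmetric_eq[OF sym_arcs]
    unfolding connected_def strongly_connected_def by auto
qed

lemma simple_tree_acyclic_rel:
  assumes "simple_tree G"
  shows "acyclic_rel (arcs_ends G)"
proof -
  interpret graph G using assms by (simp add: simple_tree_def)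
  show ?thesis
  proof
    show "sym (arcs_ends G)" using sym_arcs by (simp add: symmetric_def)
    show "(x, x) \<notin> arcs_ends G" for x using adj_not_same by blast
    fix xs :: "'a list"
    assume len: "3 \<le> length xs" and xs: "spath (arcs_ends G) xs"
    show "(last xs, hd xs) \<notin> arcs_ends G"
    proof
      assume "(last xs, hd xs) \<in> arcs_ends G"
      then obtain e where e: "e \<in> arcs G" "tail G e = last xs" "head G e = hd xs"
        by (elim reachableE)
      have "xs \<noteq> []" "hd xs \<in> verts G" using len head_in_verts[OF e(1)] e(3) by auto
      then obtain p where p: "awalk (hd xs) p (last xs)" "awalk_verts (hd xs) p = xs"
        using awalk_of_successively xs unfolding spath_def by blast
      \<comment> \<open>The closing arc comes first, so that the vertex list without its head is
        exactly \<open>xs\<close>.\<close>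
      have "awalk (last xs) (e # p) (last xs)" using p(1) e by (simp add: awalk_Cons_iff)
      moreover have "distinct (tl (awalk_verts (last xs) (e # p)))"
        using p(2) e(3) xs by (simp add: spath_def)
      ultimately have "cycle (e # p)" unfolding cycle_def by blast
      moreover have "3 \<le> length (e # p)" using len p(2) length_awalk_verts[of "hd xs" p] by simp
      ultimately show False using assms unfolding simple_tree_def by blast
    qed
  qed
qed

text \<open>A shortest walk between the ends of \<open>xs\<close> is a simple path and hence equals
  \<open>xs\<close>; its at most 5 arcs give at most 6 vertices.\<close>

lemma simple_tree_short_spath:
  assumes "simple_tree G" "graph_diam G \<le> 5" and xs: "spath (arcs_ends G) xs"
  shows "length xs \<le> 6"
\<comment> \<open>Lists with fewer than two entries are split off, because \<open>spath\<close> does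
  not force a single entry to be a vertex of \<open>G\<close>.\<close>
proof (cases xs rule: remdups_adj.cases)
  case (3 x y zs)
  interpret graph G using assms by (simp add: simple_tree_def)
  interpret acyclic_rel "arcs_ends G" by (rule simple_tree_acyclic_rel) fact
  let ?u = "hd xs" and ?v = "last xs" and ?c = "\<lambda>_. 1 :: real"
  have ne: "xs \<noteq> []" using 3 by simp
  have u: "?u \<in> verts G" using xs 3 adj_in_verts(1) by (auto simp: spath_def)
  obtain p where "awalk ?u p ?v"
    using awalk_of_successively xs ne u unfolding spath_def by blast
  then have v: "?v \<in> verts G" and reach: "?u \<rightarrow>\<^sup>*\<^bsub>G\<^esub> ?v" by (auto simp: reachable_awalk)
  have "{\<mu> ?c u v |u v. u \<in> verts G \<and> v \<in> verts G} = (\<lambda>(u, v). \<mu> ?c u v) ` (verts G \<times> verts G)"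
    by auto
  then have "finite {\<mu> ?c u v |u v. u \<in> verts G \<and> v \<in> verts G}" by simp
  then have "\<mu> ?c ?u ?v \<le> graph_diam G" unfolding graph_diam_def using u v by (intro Max_ge) auto
  then have le: "\<mu> ?c ?u ?v \<le> 5" using assms(2) by (rule order_trans)
  obtain q where q: "apath ?u q ?v" "\<mu> ?c ?u ?v = awalk_cost ?c q"
    using min_cost_awalk[OF reach, of ?c] by auto
  have "length q \<le> 5" using le q(2) by (simp add: awalk_cost_unit)
  moreover have "spath (arcs_ends G) (awalk_verts ?u q)"
    using q(1) successively_awalk_verts by (auto simp: apath_def spath_def)
  then have "awalk_verts ?u q = xs"
    using q(1) by (intro spath_unique xs ne) (auto simp: apath_def)
  then have "length xs = Suc (length q)" using length_awalk_verts[of ?u q] by simp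
  ultimately show ?thesis by simp
qed auto

section \<open>Library components and \<open>comp_of\<close>\<close>

lemma reachable_induce_imp_comp_of:
  assumes "u \<rightarrow>\<^sup>*\<^bsub>mk_symmetric C\<^esub> v" "subgraph C (G \<restriction> A)" "symmetric G"
  shows "v \<in> comp_of (arcs_ends G) A u"
proof -
  \<comment> \<open>Connectivity of \<open>C\<close> refers to its symmetric closure. A reversed arc
    of \<open>C\<close> is still an edge of the symmetric \<open>G\<close> inside
    \<open>A\<close>.\<close>
  have "(x, y) \<in> arcs_ends G \<inter> A \<times> A" if xy: "(x, y) \<in> parcs (mk_symmetric C)" for x y
  proof -
    obtain e where e: "e \<in> arcs C" "(x, y) = (tail C e, head C e) \<or> (x, y) = (head C e, tail C e)"
      using xy by (auto simp: parcs_mk_symmetric)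
    have "e \<in> arcs (G \<restriction> A)" "tail C e = tail G e" "head C e = head G e"
      using assms(2) e(1) by (auto simp: subgraph_def compatible_def)
    then have "(tail C e, head C e) \<in> arcs_ends G" "tail C e \<in> A" "head C e \<in> A"
      by (auto simp: arcs_ends_conv)
    then show ?thesis using e(2) arcs_ends_symmetric[OF assms(3)] by auto
  qed
  then have "arcs_ends (with_proj (mk_symmetric C)) \<subseteq> arcs_ends G \<inter> A \<times> A"
    by (auto simp: arcs_ends_conv)
  then show ?thesis using reachable_rtranclI[OF assms(1)] rtrancl_mono unfolding comp_of_def by blast
qed

text \<open>A walk from \<open>x\<close> inside \<open>A\<close> never leaves the component, so all
  of it is reached from \<open>x\<close> in the restriction; symmetry leads back to
  \<open>x\<close>.\<close>

lemma connected_induce_comp_of: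
  assumes "graph G" "A \<subseteq> verts G" "x \<in> A"
  shows "connected (G \<restriction> comp_of (arcs_ends G) A x)"
proof -
  interpret graph G by fact
  let ?K = "comp_of (arcs_ends G) A x"
  have K: "?K \<subseteq> A" using comp_of_subset[OF assms(3)] .
  interpret H: wf_digraph "G \<restriction> ?K"
    using K assms(2) by (intro wf_digraphI_induced induced_induce) blast
  have symE: "sym (arcs_ends G)" using sym_arcs by (simp add: symmetric_def)
  have reach: "x \<rightarrow>\<^sup>*\<^bsub>G \<restriction> ?K\<^esub> y" if "(x, y) \<in> (arcs_ends G \<inter> A \<times> A)\<^sup>*" for y
    using that
  proof induction
    case base
    then show ?case by (simp add: comp_of_self)
  next
    case (step y z)
    have "y \<in> ?K" "z \<in> ?K" using step.hyps unfolding comp_of_def by (auto intro: rtrancl_into_rtrancl)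
    then have "(y, z) \<in> arcs_ends (G \<restriction> ?K)" using step.hyps(2) by (auto simp: arcs_ends_conv)
    then show ?case using step.IH H.reachable_adj_trans by blast
  qed
  have sym: "symmetric (G \<restriction> ?K)"
    unfolding symmetric_conv
  proof
    fix e assume "e \<in> arcs (G \<restriction> ?K)"
    then show "\<exists>e'\<in>arcs (G \<restriction> ?K). tail (G \<restriction> ?K) e = head (G \<restriction> ?K) e' \<and> head (G \<restriction> ?K) e = tail (G \<restriction> ?K) e'"
      using sym_arcs unfolding symmetric_conv by force
  qed
  have "strongly_connected (G \<restriction> ?K)"
    unfolding strongly_connected_def
  proof (intro conjI ballI)
    show "verts (G \<restriction> ?K) \<noteq> {}" using comp_of_self[of x "arcs_ends G" A] by auto
    fix u v assume "u \<in> verts (G \<restriction> ?K)" "v \<in> verts (G \<restriction> ?K)"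
    then have "x \<rightarrow>\<^sup>*\<^bsub>G \<restriction> ?K\<^esub> u" "x \<rightarrow>\<^sup>*\<^bsub>G \<restriction> ?K\<^esub> v" using reach by (auto simp: comp_of_def)
    then show "u \<rightarrow>\<^sup>*\<^bsub>G \<restriction> ?K\<^esub> v" using symmetric_reachable[OF sym] H.reachable_trans by blast
  qed
  then show ?thesis
    unfolding connected_def strongly_connected_def using H.reachable_mk_symmetricI by simp
qed

text \<open>The two kinds of components need not be identified: each \<open>comp_of\<close> lies in
  a library component and each library component in a \<open>comp_of\<close>, which is enough to
  compare size bounds.\<close>

lemma r_independent_iff_small_comps:
  assumes "graph G"
  shows "r_independent r G A \<longleftrightarrow> A \<subseteq> verts G \<and> small_comps r (arcs_ends G) A"
proof (cases "A \<subseteq> verts G")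
  case A: True
  interpret graph G by fact
  have finA: "finite A" using A finite_verts finite_subset by blast
  have "(\<forall>C. connected_component (G \<restriction> A) C \<longrightarrow> card (verts C) \<le> r) \<longleftrightarrow> small_comps r (arcs_ends G) A"
  proof
    assume small: "\<forall>C. connected_component (G \<restriction> A) C \<longrightarrow> card (verts C) \<le> r"
    show "small_comps r (arcs_ends G) A"
      unfolding small_comps_def
    proof
      fix x assume x: "x \<in> A"
      let ?K = "comp_of (arcs_ends G) A x"
      have K: "?K \<subseteq> A" using comp_of_subset[OF x] .
      have fin: "fin_digraph (G \<restriction> A)"
        using fin_digraph_subgraph A by (blast intro: induced_imp_subgraph induced_induce)
      have "subgraph (G \<restriction> ?K) (G \<restriction> A)"
        using K A by (auto simp: subgraph_def compatible_def intro!: wf_digraphI_induced induced_induce)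
      then obtain D where D: "connected_component (G \<restriction> A) D" "subgraph (G \<restriction> ?K) D"
        using connected_subgraph_in_component[OF fin _ connected_induce_comp_of[OF assms A x]] by blast
      have "verts D \<subseteq> A" using D(1)
        by (auto simp: connected_component_def pre_digraph.max_subgraph_def subgraph_def)
      then have "card ?K \<le> card (verts D)"
        using D(2) finA finite_subset by (intro card_mono) (auto simp: subgraph_def)
      then show "card ?K \<le> r" using small D(1) by fastforce
    qed
  next
    assume small: "small_comps r (arcs_ends G) A"
    show "\<forall>C. connected_component (G \<restriction> A) C \<longrightarrow> card (verts C) \<le> r"
    proof (intro allI impI)
      fix C assume "connected_component (G \<restriction> A) C"
      then have C: "subgraph C (G \<restriction> A)" "connected C"
        by (auto simp: connected_component_def pre_digraph.max_subgraph_def)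
      then obtain x where x: "x \<in> verts C" by (auto simp: connected_def strongly_connected_def)
      then have xA: "x \<in> A" using C(1) by (auto simp: subgraph_def)
      have "x \<rightarrow>\<^sup>*\<^bsub>mk_symmetric C\<^esub> v" if "v \<in> verts C" for v
        using C(2) x that by (auto simp: connected_def strongly_connected_def)
      then have "verts C \<subseteq> comp_of (arcs_ends G) A x"
        using reachable_induce_imp_comp_of[OF _ C(1) sym_arcs] by blast
      then have "card (verts C) \<le> card (comp_of (arcs_ends G) A x)"
        using finA by (intro card_mono finite_comp_of)
      then show "card (verts C) \<le> r" using small xA unfolding small_comps_def by fastforce
    qed
  qed
  then show ?thesis using A by (simp add: r_independent_def)
qed (simp add: r_independent_def)

lemma has_shelling_imp_shellable:
  "has_shelling K \<Longrightarrow> (\<And>F. F \<in> K \<Longrightarrow> finite F) \<Longrightarrow> shellable K"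
  using shelling_order_imp_shellable by (auto simp: has_shelling_def)

theorem theorem4p9:
  fixes G :: "('a, 'b) pre_digraph" and r :: nat
  assumes "simple_tree G" and "graph_diam G \<le> 5" and "2 \<le> r"
  shows "shellable (Ind r G)"
proof -
  interpret graph G using assms(1) by (simp add: simple_tree_def)
  let ?E = "arcs_ends G"
  have conn: "connected G" using assms(1) by (simp add: simple_tree_def)
  have Ind: "Ind r G = {A. A \<subseteq> verts G \<and> small_comps r ?E A}"
    using r_independent_iff_small_comps[OF graph_axioms] by (simp add: Ind_def)
  have "has_shelling (Ind r G)"
  proof (cases "card (verts G) \<ge> 2")
    case True
    interpret acyclic_rel ?E by (rule simple_tree_acyclic_rel) fact
    interpret short_tree ?E "verts G"
    proof
      show "arcs_ends G \<subseteq> verts G \<times> verts G" by (auto dest: adj_in_verts)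
      show "(u, v) \<in> ?E\<^sup>*" if "u \<in> verts G" "v \<in> verts G" for u v
        using reachable_rtranclI[OF connected_imp_reachable[OF graph_axioms conn that]] .
      show "length xs \<le> 6" if "spath ?E xs" for xs
        using simple_tree_short_spath[OF assms(1,2) that] .
    qed simp
    obtain a b C L par where "double_star r ?E a b C L par" "verts G = {a, b} \<union> C \<union> L"
      using double_star_exists[OF True, of r] assms(3) by auto
    then show ?thesis using double_star.has_shelling_double_star Ind by metis
  next
    case False
    \<comment> \<open>A single vertex has no central edge; its complex is the cone over the empty
      face.\<close>
    have "verts G \<noteq> {}" using conn by (auto simp: connected_def strongly_connected_def)
    then have "card (verts G) = 1" using False card_gt_0_iff[of "verts G"] by auto
    then obtain v where v: "verts G = {v}" by (auto simp: card_1_singleton_iff)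
    have "simplicial_complex_on (verts G) (Ind r G)"
      by (rule Ind_simplicial_complex[OF graph_axioms]) (use assms(3) in simp)
    then have "Ind r G = {{}} \<union> insert v ` {{}}"
      unfolding simplicial_complex_on_def v by auto
    then show ?thesis using has_shelling_cone[OF has_shelling_empty_face, of v] by simp
  qed
  then show ?thesis
    by (rule has_shelling_imp_shellable) (auto simp: Ind intro: finite_subset[OF _ finite_verts])
qed

end
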